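(* Each second order critical hole (SOCH) for the doubling map is one of the following, where $r_1,r_2,\dots$ denote elements of $\mathbb Q\cap(0,1)$, $s_n=\rho_{r_1}\cdots\rho_{r_n}(0)$ and $t_n=\rho_{r_1}\cdots\rho_{r_n}(1)$: \begin{itemize} \item $(a,1/2)$ or $(1/2,1-a)$ for any $a\in(0,1/4]$; \item $(a,a+1/4)$, where $a\in\mathcal S$; \item $\bigl(a,\,a+(1-2^{-Q_{n-1}})(t_{n-1}-s_{n-1})\bigr)$, where $a\in\mathcal S_n(r_1,\dots,r_{n-1})$ for some $(r_1,\dots,r_{n-1})\in(\mathbb Q\cap(0,1))^{n-1}$ (with $n\ge2$); \item $(s_n^\infty,b)$, where $s_n=\rho_{r_1}\cdots\rho_{r_n}(0)$ and $b\in[t_ns_nt_n^\infty,t_n^\infty]$ with $t_n=\rho_{r_1}\cdots\rho_{r_n}(1)$; \item $(a,t_ns_n^\infty)$ with $a\in(s_n^\infty,s_nt_ns_n^\infty]$; \item $(\mathfrak s(\boldsymbol r),\mathfrak t(\boldsymbol r))$ for some $\boldsymbol r\in(\mathbb Q\cap(0,1))^{\mathbb N}$. \end{itemize}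
   Context: Doubling map: $T:[0,1]\to[0,1]$, $Tx=2x$ for $x\in[0,1/2]$, $Tx=2x-1$ for $x\in(1/2,1]$. For $0<a<b<1$ (a "hole" $(a,b)$) put $\mathcal J(a,b)=\{x\in[0,1]: T^nx\notin(a,b)\text{ for all }n\ge0\}$. A hole $(a_0,b_0)$ is a second order critical hole (SOCH) if: (1) for any hole $(a,b)$ with $a<a_0$, $b>b_0$ the set $\mathcal J(a,b)$ is (finite or infinite) countable; and (2) for any hole $(a,b)$ with $a>a_0$, $b<b_0$ we have $\dim_H\mathcal J(a,b)>0$ (Hausdorff dimension). Words have letters in $\{0,1\}$; concatenation is juxtaposition, $u^\infty=uuu\cdots$, $|u|$ is the length of $u$ and $|u|_1$ the number of 1s. An infinite word $w_1w_2\dots$ is identified with the real number $\sum_{n\ge1}w_n2^{-n}$; in arithmetic expressions a finite word $w_1\dots w_m$ stands for $\sum_{n=1}^m w_n2^{-n}$. A word is balanced if any two of its factors $u,v$ of equal length satisfy $||u|_1-|v|_1|\le1$; a finite word $w$ is cyclically balanced if $w^2$ is balanced. For $r=p/q\in\mathbb Q\cap(0,1)$ in lowest terms, $\omega_r^-$ is the lexicographically largest cyclically balanced word of length $q$ with exactly $p$ ones beginning with 0, and $\omega_r^+$ is the lexicographically smallest cyclically balanced word of length $q$ with exactly $p$ ones beginning with 1. The substitution $\rho_r$ sends $0\mapsto\omega_r^-$, $1\mapsto\omega_r^+$ and extends to words by concatenation; $\rho_{r_1}\cdots\rho_{r_n}$ is a composition. With $r_i=p_i/q_i$ in lowest terms,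 $Q_n=q_1\cdots q_n=|s_n|=|t_n|$, $\Delta(r_1,\dots,r_n)=[s_n^\infty,s_nt_n^\infty]$, $\widetilde\Delta(r_1,\dots,r_n)=[s_nt_ns_n^\infty,s_nt_n^\infty]$, $\mathcal S=(1/4,1/2)\setminus\bigcup_{r\in\mathbb Q\cap(0,1)}\Delta(r)$ and, for $n\ge2$, $\mathcal S_n(r_1,\dots,r_{n-1})=\widetilde\Delta(r_1,\dots,r_{n-1})\setminus\bigcup_{r_n\in\mathbb Q\cap(0,1)}\Delta(r_1,\dots,r_n)$. For $\boldsymbol r=(r_1,r_2,\dots)$ put $\mathfrak s(\boldsymbol r)=\lim_n\rho_{r_1}\cdots\rho_{r_n}(0)$, $\mathfrak t(\boldsymbol r)=\lim_n\rho_{r_1}\cdots\rho_{r_n}(1)$ (coordinatewise limits).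
   Formalization: In the fourth item the left end point is s_n t_n^∞ instead of s_n^∞, and in the fifth item a ranges over the closed interval [s_n^∞, s_n t_n s_n^∞]; as printed, the list omits the SOCHs (5/12, 5/8) and (1/3, 7/12). *)

theory Defs
  imports
    "HOL-Analysis.Analysis"
    "HOL-Library.Omega_Words_Fun"
    "HOL-Library.Sublist"
    "HOL-Library.List_Lexorder"
begin

section \<open>Hausdorff dimension\<close>

text \<open>
  The \<open>\<delta>\<close>-premeasure is an infimum over countable covers by sets of diameter at most \<open>\<delta>\<close>.
  Boundedness of the covering sets is required because \<^const>\<open>diameter\<close> is a real number, with
  no meaning on unbounded sets.  Finite covers are included: pad with empty sets, which
  contribute \<open>0 powr s = 0\<close>.
\<close>

definition hausdorff_premeasure :: "real \<Rightarrow> real \<Rightarrow> 'a::metric_space set \<Rightarrow> ennreal" where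
  "hausdorff_premeasure s \<delta> E =
     (INF U \<in> {U :: nat \<Rightarrow> 'a set. E \<subseteq> (\<Union>i. U i) \<and> (\<forall>i. bounded (U i) \<and> diameter (U i) \<le> \<delta>)}.
        \<Sum>i. ennreal (diameter (U i) powr s))"

definition hausdorff_outer_measure :: "real \<Rightarrow> 'a::metric_space set \<Rightarrow> ennreal" where
  "hausdorff_outer_measure s E = (SUP \<delta> \<in> {0<..}. hausdorff_premeasure s \<delta> E)"

text \<open>
  Only \<open>s > 0\<close> is used, so that \<open>0 powr 0 = 0\<close> (where one would want 1) plays no role;
  this does not affect the infimum.
\<close>

definition hausdorff_dim :: "'a::metric_space set \<Rightarrow> ennreal" where
  "hausdorff_dim E = Inf {ennreal s |s. s > 0 \<and> hausdorff_outer_measure s E = 0}"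


section \<open>Holes for the doubling map\<close>

text \<open>
  Regarded as a total function on the reals; it maps \<open>{0..1}\<close> into itself, and only orbits of
  points of \<open>{0..1}\<close> are considered.
\<close>

definition doubling :: "real \<Rightarrow> real" where
  "doubling x = (if x \<le> 1/2 then 2 * x else 2 * x - 1)"

definition survivor :: "real \<Rightarrow> real \<Rightarrow> real set" where
  "survivor a b = {x \<in> {0..1}. \<forall>n. (doubling ^^ n) x \<notin> {a<..<b}}"

definition hole :: "real \<Rightarrow> real \<Rightarrow> bool" where
  "hole a b \<longleftrightarrow> 0 < a \<and> a < b \<and> b < 1"

definition SOCH :: "real \<Rightarrow> real \<Rightarrow> bool" where
  "SOCH a\<^sub>0 b\<^sub>0 \<longleftrightarrow> hole a\<^sub>0 b\<^sub>0 \<and>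
     (\<forall>a b. hole a b \<and> a < a\<^sub>0 \<and> b > b\<^sub>0 \<longrightarrow> countable (survivor a b)) \<and>
     (\<forall>a b. hole a b \<and> a > a\<^sub>0 \<and> b < b\<^sub>0 \<longrightarrow> hausdorff_dim (survivor a b) > 0)"


section \<open>Binary words\<close>

text \<open>
  The letter 0 is \<^const>\<open>False\<close> and the letter 1 is \<^const>\<open>True\<close>.  Finite words are lists, ordered
  lexicographically with \<open>False < True\<close>; infinite words are functions on \<^typ>\<open>nat\<close>,
  indexed from 0, so that the letter at position \<open>n\<close> has weight \<open>2 ^ -(n+1)\<close>.
\<close>

definition ones :: "bool list \<Rightarrow> nat" where
  "ones w = count_list w True"

definition val :: "bool list \<Rightarrow> real" where
  "val w = (\<Sum>n<length w. of_bool (w ! n) / 2 ^ Suc n)"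

definition val\<^sub>\<omega> :: "bool word \<Rightarrow> real" where
  "val\<^sub>\<omega> w = (\<Sum>n. of_bool (w n) / 2 ^ Suc n)"

definition balanced :: "bool list \<Rightarrow> bool" where
  "balanced w \<longleftrightarrow> (\<forall>u v. sublist u w \<and> sublist v w \<and> length u = length v
                     \<longrightarrow> \<bar>int (ones u) - int (ones v)\<bar> \<le> 1)"

definition cyclically_balanced :: "bool list \<Rightarrow> bool" where
  "cyclically_balanced w \<longleftrightarrow> balanced (w @ w)"


section \<open>Balanced words with given slope and the substitutions\<close>

abbreviation slopes :: "rat set" where
  "slopes \<equiv> {0<..<1}"

definition numer :: "rat \<Rightarrow> nat" where
  "numer r = nat (fst (quotient_of r))"

definition denom :: "rat \<Rightarrow> nat" where
  "denom r = nat (snd (quotient_of r))"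

definition balanced_words :: "rat \<Rightarrow> bool \<Rightarrow> bool list set" where
  "balanced_words r c =
     {w. cyclically_balanced w \<and> length w = denom r \<and> ones w = numer r \<and> hd w = c}"

definition omega_minus :: "rat \<Rightarrow> bool list" where
  "omega_minus r = Max (balanced_words r False)"

definition omega_plus :: "rat \<Rightarrow> bool list" where
  "omega_plus r = Min (balanced_words r True)"

definition subst :: "rat \<Rightarrow> bool list \<Rightarrow> bool list" where
  "subst r w = concat (map (\<lambda>c. if c then omega_plus r else omega_minus r) w)"

text \<open>
  \<open>foldr subst [r\<^sub>1, \<dots>, r\<^sub>n] w = subst r\<^sub>1 (\<dots> (subst r\<^sub>n w))\<close>, i.e. the substitution with the last
  slope is applied first.
\<close>

definition s_word :: "rat list \<Rightarrow> bool list" where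
  "s_word rs = foldr subst rs [False]"

definition t_word :: "rat list \<Rightarrow> bool list" where
  "t_word rs = foldr subst rs [True]"

definition Q :: "rat list \<Rightarrow> nat" where
  "Q rs = prod_list (map denom rs)"

definition \<Delta> :: "rat list \<Rightarrow> real set" where
  "\<Delta> rs = {val\<^sub>\<omega> ((s_word rs)\<^sup>\<omega>) .. val\<^sub>\<omega> (s_word rs \<frown> (t_word rs)\<^sup>\<omega>)}"

definition \<Delta>\<^sub>t :: "rat list \<Rightarrow> real set" where
  "\<Delta>\<^sub>t rs = {val\<^sub>\<omega> (s_word rs \<frown> t_word rs \<frown> (s_word rs)\<^sup>\<omega>) ..
            val\<^sub>\<omega> (s_word rs \<frown> (t_word rs)\<^sup>\<omega>)}"

definition S_set :: "real set" where
  "S_set = {1/4<..<1/2} - (\<Union>r\<in>slopes. \<Delta> [r])"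

definition S_sets :: "rat list \<Rightarrow> real set" where
  "S_sets rs = \<Delta>\<^sub>t rs - (\<Union>r\<in>slopes. \<Delta> (rs @ [r]))"

text \<open>The coordinatewise limit of a sequence of finite words whose lengths tend to infinity.\<close>

definition word_lim :: "(nat \<Rightarrow> bool list) \<Rightarrow> bool word" where
  "word_lim u = (\<lambda>k. THE c. \<forall>\<^sub>F n in sequentially. k < length (u n) \<and> u n ! k = c)"

definition s_lim :: "(nat \<Rightarrow> rat) \<Rightarrow> bool word" where
  "s_lim r = word_lim (\<lambda>n. s_word (map r [0..<n]))"

definition t_lim :: "(nat \<Rightarrow> rat) \<Rightarrow> bool word" where
  "t_lim r = word_lim (\<lambda>n. t_word (map r [0..<n]))"

text \<open>
  For slopes \<open>rs\<close> with \<open>s = s_word rs\<close> and \<open>t = t_word rs\<close>, the second order critical holes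
  whose left end point lies in \<open>\<Delta> rs\<close> start at \<open>(s\<^sup>\<omega>, t s\<^sup>\<omega>)\<close> and run through a horizontal segment
  up to \<open>(s t s\<^sup>\<omega>, t s\<^sup>\<omega>)\<close>; they end with a vertical segment from \<open>(s t\<^sup>\<omega>, t s t\<^sup>\<omega>)\<close> to
  \<open>(s t\<^sup>\<omega>, t\<^sup>\<omega>)\<close>.  The reflection \<open>(a, b) \<mapsto> (1 - b, 1 - a)\<close>, which exchanges the letters, takes
  one segment for a slope to the other one for the complementary slope.  So the vertical
  segment lies over \<open>s t\<^sup>\<omega>\<close>, not over \<open>s\<^sup>\<omega>\<close>, and the horizontal one includes its left end point.
\<close>

end

theory Submission
  imports Defs
begin

text \<open>
  Write \<open>L : 0 \<mapsto> 0, 1 \<mapsto> 10\<close>, \<open>R : 0 \<mapsto> 01, 1 \<mapsto> 1\<close> and \<open>T : 0 \<mapsto> 01, 1 \<mapsto> 10\<close>.  By the Euclidean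
  algorithm on the slope, the substitutions \<open>\<rho>\<^sub>r\<close> are exactly the products \<open>M T\<close> with \<open>M\<close> in the
  monoid generated by \<open>L\<close> and \<open>R\<close>.

  Let \<open>f\<close> be a product of \<open>L\<close>, \<open>R\<close>, \<open>T\<close>.  Words avoiding the hole \<open>(f(010\<^sup>\<omega>), f(10\<^sup>\<omega>))\<close> or
  \<open>(f(01\<^sup>\<omega>), f(101\<^sup>\<omega>))\<close> can be desubstituted one generator at a time, so there are countably many;
  on the other hand all images under \<open>f\<close> avoid \<open>(f(01\<^sup>\<omega>), f(10\<^sup>\<omega>))\<close>.  Applying this to \<open>f L\<^sup>n T\<close> and
  \<open>f R\<^sup>n T\<close> and letting \<open>n\<close> grow, every second order critical hole \<open>(a, b)\<close> satisfies
  \<open>a \<le> f(010\<^sup>\<omega>) \<longleftrightarrow> b \<le> f(10\<^sup>\<omega>)\<close> and \<open>a < f(01\<^sup>\<omega>) \<longleftrightarrow> b < f(101\<^sup>\<omega>)\<close>.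

  Let now \<open>f = \<rho>\<^bsub>r\<^sub>1\<^esub> \<dots> \<rho>\<^bsub>r\<^sub>n\<^esub>\<close>.  For \<open>M\<close> in the monoid of \<open>L\<close> and \<open>R\<close>, the interval
  \<open>[f M(010\<^sup>\<omega>), f M(01\<^sup>\<omega>)]\<close> is the union of its counterparts for \<open>M L\<close> and \<open>M R\<close> and of the plateau
  \<open>\<Delta>\<close> belonging to \<open>M\<close> between them.  The two equivalences put \<open>a\<close> and \<open>b - c\<close>, where
  \<open>c = (1 - 2\<^bsup>-Q\<^esup>)(t - s)\<close>, on the same side of each plateau, so if \<open>a\<close> lies in no plateau, both are
  in nested intervals of length tending to 0 and \<open>b = a + c\<close>.  If \<open>a\<close> lies in a plateau, the same
  equivalences leave a horizontal segment, a vertical segment, and a box in which the argument is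
  repeated with one more slope; infinite repetition gives the limit words.
\<close>

abbreviation shift :: "nat \<Rightarrow> bool word \<Rightarrow> bool word" where
  "shift n w \<equiv> Omega_Words_Fun.suffix n w"

abbreviation initial :: "nat \<Rightarrow> bool word \<Rightarrow> bool list" where
  "initial n w \<equiv> Omega_Words_Fun.prefix n w"

section \<open>Lexicographic order on infinite words\<close>

text \<open>The order lives on words and not on their values, because the two expansions of a dyadic
  number are different words. \<open>val_mono\<close> and \<open>val_strict_mono\<close> later pass
  to real numbers.\<close>

definition lex_less :: "bool word \<Rightarrow> bool word \<Rightarrow> bool" (infix "\<sqsubset>" 50) where
  "x \<sqsubset> y \<longleftrightarrow> (\<exists>n. (\<forall>i<n. x i = y i) \<and> \<not> x n \<and> y n)"

definition lex_le :: "bool word \<Rightarrow> bool word \<Rightarrow> bool" (infix "\<sqsubseteq>" 50) where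
  "x \<sqsubseteq> y \<longleftrightarrow> x = y \<or> x \<sqsubset> y"

lemma lex_less_build [simp]: "(c ## x) \<sqsubset> (d ## y) \<longleftrightarrow> \<not> c \<and> d \<or> c = d \<and> x \<sqsubset> y"
proof
  assume "(c ## x) \<sqsubset> (d ## y)"
  then obtain n where n: "\<forall>i<n. (c ## x) i = (d ## y) i" "\<not> (c ## x) n" "(d ## y) n"
    unfolding lex_less_def by blast
  show "\<not> c \<and> d \<or> c = d \<and> x \<sqsubset> y"
  proof (cases n)
    case 0
    with n show ?thesis by simp
  next
    case (Suc m)
    have "c = d" using n(1) Suc by (metis build.simps(1) zero_less_Suc)
    moreover have "\<forall>i<m. x i = y i" using n(1) Suc by (metis build.simps(2) Suc_less_eq)
    ultimately show ?thesis using n Suc unfolding lex_less_def by auto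
  qed
next
  assume "\<not> c \<and> d \<or> c = d \<and> x \<sqsubset> y"
  then show "(c ## x) \<sqsubset> (d ## y)"
  proof
    assume "\<not> c \<and> d"
    then show ?thesis unfolding lex_less_def by (intro exI[of _ 0]) auto
  next
    assume a: "c = d \<and> x \<sqsubset> y"
    then obtain n where "\<forall>i<n. x i = y i" "\<not> x n" "y n" unfolding lex_less_def by blast
    with a show ?thesis unfolding lex_less_def
      by (intro exI[of _ "Suc n"]) (auto simp: less_Suc_eq_0_disj)
  qed
qed

lemma lex_le_build [simp]: "(c ## x) \<sqsubseteq> (d ## y) \<longleftrightarrow> \<not> c \<and> d \<or> c = d \<and> x \<sqsubseteq> y"
  by (auto simp: lex_le_def)

lemma lex_less_conc [simp]: "(u \<frown> x) \<sqsubset> (u \<frown> y) \<longleftrightarrow> x \<sqsubset> y"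
  by (induction u) auto

lemma lex_le_refl [simp]: "x \<sqsubseteq> x"
  by (simp add: lex_le_def)

lemma lex_less_irrefl [simp]: "\<not> x \<sqsubset> x"
  by (auto simp: lex_less_def)

lemma lex_less_trans: "x \<sqsubset> y \<Longrightarrow> y \<sqsubset> z \<Longrightarrow> x \<sqsubset> z"
proof -
  assume "x \<sqsubset> y" "y \<sqsubset> z"
  then obtain n m where n: "\<forall>i<n. x i = y i" "\<not> x n" "y n"
    and m: "\<forall>i<m. y i = z i" "\<not> y m" "z m"
    unfolding lex_less_def by blast
  have "n \<noteq> m" using n m by auto
  then show ?thesis unfolding lex_less_def
    using n m by (intro exI[of _ "min n m"]) (auto simp: min_def)
qed

lemma lex_linear: "x \<sqsubset> y \<or> x = y \<or> y \<sqsubset> x"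
proof (cases "x = y")
  case False
  then have ex: "\<exists>n. x n \<noteq> y n" by auto
  define n where "n = (LEAST n. x n \<noteq> y n)"
  have n: "x n \<noteq> y n" unfolding n_def using ex by (rule LeastI_ex)
  have "\<forall>i<n. x i = y i" unfolding n_def using not_less_Least by blast
  then show ?thesis using n unfolding lex_less_def by (cases "x n") auto
qed auto

lemma lex_not_le: "\<not> x \<sqsubseteq> y \<longleftrightarrow> y \<sqsubset> x"
  using lex_linear[of x y] lex_less_trans[of x y x] by (auto simp: lex_le_def)

lemma lex_le_trans: "x \<sqsubseteq> y \<Longrightarrow> y \<sqsubseteq> z \<Longrightarrow> x \<sqsubseteq> z"
  using lex_less_trans by (auto simp: lex_le_def)

abbreviation zeros_w :: "bool word" ("\<zero>\<^sup>\<omega>") where "\<zero>\<^sup>\<omega> \<equiv> \<lambda>_. False"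
abbreviation ones_w :: "bool word" ("\<one>\<^sup>\<omega>") where "\<one>\<^sup>\<omega> \<equiv> \<lambda>_. True"

lemma lex_le_ones [simp]: "x \<sqsubseteq> \<one>\<^sup>\<omega>"
  by (metis lex_not_le lex_less_def)

lemma zeros_lex_le [simp]: "\<zero>\<^sup>\<omega> \<sqsubseteq> x"
  by (metis lex_not_le lex_less_def)

lemma build_suffix: "w n ## shift (Suc n) w = shift n w"
proof
  show "(w n ## shift (Suc n) w) i = shift n w i" for i by (cases i) auto
qed

text \<open>These rules compare a tail with an explicit first letter directly; rewriting
  \<open>shift n w\<close> by its own first letter would not terminate as a simplification
  rule.\<close>

lemma lex_le_shift [simp]:
  "shift n w \<sqsubseteq> d ## y \<longleftrightarrow> \<not> w n \<and> d \<or> w n = d \<and> shift (Suc n) w \<sqsubseteq> y"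
  "c ## x \<sqsubseteq> shift n w \<longleftrightarrow> \<not> c \<and> w n \<or> c = w n \<and> x \<sqsubseteq> shift (Suc n) w"
  unfolding build_suffix[of w n, symmetric] lex_le_build by (rule refl)+

lemma build_const: "c ## (\<lambda>_. c) = (\<lambda>_. c)"
proof
  show "(c ## (\<lambda>_. c)) i = c" for i by (cases i) auto
qed

text \<open>Beyond the first copy of \<open>u\<close>, unrolling once moves position
  \<open>n\<close> to \<open>n - length u\<close>, which is smaller because \<open>u\<close> is
  nonempty.\<close>

lemma iter_unique:
  assumes "x = u \<frown> x" "u \<noteq> []"
  shows "x = u\<^sup>\<omega>"
proof
  fix n show "x n = (u\<^sup>\<omega>) n"
  proof (induction n rule: less_induct)
    case (less n)
    have 1: "x n = (u \<frown> x) n" using assms by simp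
    have 2: "(u\<^sup>\<omega>) n = (u \<frown> u\<^sup>\<omega>) n" using iter_unroll[of u] assms(2) by (metis length_greater_0_conv)
    show ?case
    proof (cases "n < length u")
      case False
      have "n - length u < n" using assms(2) False by (cases u) auto
      from less.IH[OF this] show ?thesis unfolding 1 2 using False by (simp only: conc_snd not_False_eq_True)
    qed (simp only: 1 2 conc_fst)
  qed
qed

section \<open>Substitutions\<close>

type_synonym substitution = "bool \<Rightarrow> bool list"

abbreviation subst_word :: "substitution \<Rightarrow> bool list \<Rightarrow> bool list" where
  "subst_word f u \<equiv> concat (map f u)"

text \<open>For a marked \<open>f\<close> every image is nonempty, so the image of the first
  \<open>k + 1\<close> letters has a letter at position \<open>k\<close>, and longer prefixes only
  extend it. For other \<open>f\<close> the index may be out of range.\<close>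

definition subst_inf :: "substitution \<Rightarrow> bool word \<Rightarrow> bool word" where
  "subst_inf f x = (\<lambda>k. subst_word f (initial (Suc k) x) ! k)"

definition subst_comp :: "substitution \<Rightarrow> substitution \<Rightarrow> substitution" (infixr "\<odot>" 70) where
  "f \<odot> g = (\<lambda>c. subst_word f (g c))"

text \<open>Keeping the first letter makes \<open>f\<close> nonerasing and strictly monotone, and
  lets a letter be read off its image.\<close>

definition marked :: "substitution \<Rightarrow> bool" where
  "marked f \<longleftrightarrow> (\<forall>c. \<exists>u. f c = c # u)"

lemma marked_nonempty: "marked f \<Longrightarrow> f c \<noteq> []"
  unfolding marked_def by (metis list.distinct(1))

lemma marked_hd: "marked f \<Longrightarrow> f c = c # tl (f c)"
  unfolding marked_def by (metis list.sel(3))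

lemma length_subst_word:
  assumes "marked f"
  shows "length u \<le> length (subst_word f u)"
proof (induction u)
  case (Cons c u)
  then show ?case using marked_nonempty[OF assms, of c] by (cases "f c") auto
qed auto

lemma subst_inf_build:
  assumes "marked f"
  shows "subst_inf f (c ## x) = f c \<frown> subst_inf f x"
proof
  fix k
  have pre: "initial (Suc k) (c ## x) = c # initial k x"
    by (rule nth_equalityI) (auto simp: nth_Cons split: nat.splits simp del: subseq_to_Suc)
  show "subst_inf f (c ## x) k = (f c \<frown> subst_inf f x) k"
  proof (cases "k < length (f c)")
    case True
    then show ?thesis by (simp add: subst_inf_def pre nth_append del: subseq_to_Suc)
  next
    case False
    define j where "j = k - length (f c)"
    have "length (f c) > 0" using marked_nonempty[OF assms] by simp
    then have j: "Suc j \<le> k" using False j_def by linarith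
    then obtain d where d: "k = Suc j + d" using le_Suc_ex by blast
    have "subst_word f (initial k x) ! j = subst_word f (initial (Suc j) x) ! j"
      unfolding d subsequence_append
      using length_subst_word[OF assms, of "initial (Suc j) x"]
      by (simp add: nth_append del: subseq_to_Suc)
    then show ?thesis using False
      by (simp add: subst_inf_def pre nth_append j_def del: subseq_to_Suc)
  qed
qed

lemma subst_inf_conc:
  assumes "marked f"
  shows "subst_inf f (u \<frown> x) = subst_word f u \<frown> subst_inf f x"
  by (induction u) (auto simp: subst_inf_build[OF assms])

lemma subst_inf_iter:
  assumes "marked f" "u \<noteq> []"
  shows "subst_inf f (u\<^sup>\<omega>) = (subst_word f u)\<^sup>\<omega>"
proof (rule iter_unique)
  have "u\<^sup>\<omega> = u \<frown> u\<^sup>\<omega>" using assms iter_unroll by auto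
  then show "subst_inf f (u\<^sup>\<omega>) = subst_word f u \<frown> subst_inf f (u\<^sup>\<omega>)"
    using subst_inf_conc[OF assms(1)] by metis
  show "subst_word f u \<noteq> []" using assms marked_nonempty by (cases u) auto
qed

lemma const_iter: "(\<lambda>_. c) = [c]\<^sup>\<omega>"
  by (rule iter_unique) (auto simp: build_const)

lemma subst_inf_const: "marked f \<Longrightarrow> subst_inf f (\<lambda>_. c) = (f c)\<^sup>\<omega>"
  using subst_inf_iter[of f "[c]"] by (simp add: const_iter)

text \<open>The recursion equation determines a function on infinite words, since nonempty images
  reach every position after finitely many steps. Compositions and the identity are recognised this
  way.\<close>

lemma subst_inf_unique:
  assumes F: "\<And>c x. F (c ## x) = f c \<frown> F x" and m: "marked f"
  shows "F x = subst_inf f x"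
proof
  fix n show "F x n = subst_inf f x n"
  proof (induction n arbitrary: x rule: less_induct)
    case (less n)
    have x: "x = x 0 ## shift (Suc 0) x" by simp
    have 1: "F x = f (x 0) \<frown> F (shift (Suc 0) x)" by (subst x, subst F) simp
    have 2: "subst_inf f x = f (x 0) \<frown> subst_inf f (shift (Suc 0) x)"
      by (subst x, subst subst_inf_build[OF m]) simp
    show ?case
    proof (cases "n < length (f (x 0))")
      case False
      have "n - length (f (x 0)) < n" using marked_hd[OF m, of "x 0"] False by (cases "f (x 0)") auto
      from less.IH[OF this] show ?thesis unfolding 1 2 using False by (simp only: conc_snd not_False_eq_True)
    qed (simp only: 1 2 conc_fst)
  qed
qed

lemma marked_comp [intro]: "marked f \<Longrightarrow> marked g \<Longrightarrow> marked (f \<odot> g)"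
  unfolding marked_def subst_comp_def
  by (metis append_Cons concat.simps(2) list.simps(9))

lemma subst_word_comp: "subst_word (f \<odot> g) u = subst_word f (subst_word g u)"
  by (induction u) (auto simp: subst_comp_def)

lemma subst_inf_comp:
  assumes "marked f" "marked g"
  shows "subst_inf (f \<odot> g) x = subst_inf f (subst_inf g x)"
proof (rule subst_inf_unique[symmetric])
  show "subst_inf f (subst_inf g (c ## x)) = (f \<odot> g) c \<frown> subst_inf f (subst_inf g x)" for c x
    by (simp add: subst_inf_build subst_inf_conc assms subst_comp_def)
qed (use assms in auto)

lemma subst_comp_assoc: "(f \<odot> g) \<odot> h = f \<odot> g \<odot> h"
  by (rule ext) (simp add: subst_comp_def subst_word_comp[unfolded subst_comp_def])

definition subst_id :: substitution where "subst_id c = [c]"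

lemma marked_id [simp, intro]: "marked subst_id"
  by (simp add: marked_def subst_id_def)

lemma subst_id_word [simp]: "subst_word subst_id u = u"
  by (induction u) (auto simp: subst_id_def)

lemma subst_id_comp [simp]: "subst_id \<odot> f = f" "f \<odot> subst_id = f"
  by (rule ext, simp add: subst_comp_def)+ (simp add: subst_id_def)

lemma subst_inf_id [simp]: "subst_inf subst_id x = x"
  by (rule subst_inf_unique[symmetric, where F = "\<lambda>x. x"]) (auto simp: subst_id_def)

text \<open>At the first difference the two words read 0 and 1, and the images of these letters
  begin with 0 and 1 again.\<close>

lemma subst_inf_less:
  assumes m: "marked f" and "x \<sqsubset> y"
  shows "subst_inf f x \<sqsubset> subst_inf f y"
proof -
  obtain n where n: "\<forall>i<n. x i = y i" "\<not> x n" "y n" using assms(2) unfolding lex_less_def by blast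
  have x: "x = initial n x \<frown> False ## shift (Suc n) x" using n build_suffix[of x n] by simp
  have "initial n y = initial n x" using n(1) by (auto simp: subsequence_def)
  then have y: "y = initial n x \<frown> True ## shift (Suc n) y"
    using n build_suffix[of y n] by (metis (full_types) prefix_suffix)
  have "f False = False # tl (f False)" "f True = True # tl (f True)"
    using marked_hd[OF m] by blast+
  then have "(f False \<frown> z) \<sqsubset> (f True \<frown> z')" for z z'
    by (metis build_cons lex_less_build)
  then show ?thesis
    unfolding arg_cong[OF x, of "subst_inf f"] arg_cong[OF y, of "subst_inf f"]
    unfolding subst_inf_conc[OF m] subst_inf_build[OF m] lex_less_conc .
qed

lemma subst_inf_le: "marked f \<Longrightarrow> x \<sqsubseteq> y \<Longrightarrow> subst_inf f x \<sqsubseteq> subst_inf f y"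
  using subst_inf_less by (auto simp: lex_le_def)

lemma subst_inf_le_iff: "marked f \<Longrightarrow> subst_inf f x \<sqsubseteq> subst_inf f y \<longleftrightarrow> x \<sqsubseteq> y"
  using subst_inf_less subst_inf_le lex_not_le by blast

lemma suffix_subst_inf:
  assumes "marked f"
  obtains j where "m \<le> j" "shift j (subst_inf f x) = subst_inf f (shift m x)"
proof
  show "m \<le> length (subst_word f (initial m x))"
    using length_subst_word[OF assms, of "initial m x"] by simp
  have "subst_inf f x = subst_word f (initial m x) \<frown> subst_inf f (shift m x)"
    using subst_inf_conc[OF assms, of "initial m x" "shift m x"] by simp
  then show "shift (length (subst_word f (initial m x))) (subst_inf f x) = subst_inf f (shift m x)"
    by simp
qed

text \<open>A tail of an image starts inside the image of one letter. Advancing by one position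
  either stays in that block or enters the next.\<close>

lemma suffix_subst_inf_cases:
  assumes "marked f"
  shows "\<exists>m j. j < length (f (x m)) \<and>
    shift n (subst_inf f x) = drop j (f (x m)) \<frown> subst_inf f (shift (Suc m) x)"
proof (induction n)
  case 0
  have "subst_inf f x = f (x 0) \<frown> subst_inf f (shift (Suc 0) x)"
    using subst_inf_build[OF assms, of "x 0" "shift (Suc 0) x"] by (simp only: build_first)
  then have "shift 0 (subst_inf f x) = drop 0 (f (x 0)) \<frown> subst_inf f (shift (Suc 0) x)"
    by (simp only: suffix_0 drop_0)
  then show ?case using marked_nonempty[OF assms] by blast
next
  case (Suc n)
  then obtain m j where mj: "j < length (f (x m))"
    "shift n (subst_inf f x) = drop j (f (x m)) \<frown> subst_inf f (shift (Suc m) x)" by blast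
  have s: "shift (Suc n) (subst_inf f x) = shift 1 (shift n (subst_inf f x))" by simp
  show ?case
  proof (cases "Suc j < length (f (x m))")
    case True
    have "shift (Suc n) (subst_inf f x) = drop (Suc j) (f (x m)) \<frown> subst_inf f (shift (Suc m) x)"
      unfolding s mj(2) using True by (subst suffix_conc_fst) auto
    then show ?thesis using True by blast
  next
    case False
    have "shift (Suc n) (subst_inf f x) = subst_inf f (shift (Suc m) x)"
      unfolding s mj(2) using False mj(1) by (subst suffix_conc_snd) auto
    also have "\<dots> = f (x (Suc m)) \<frown> subst_inf f (shift (Suc (Suc m)) x)"
      using subst_inf_build[OF assms, of "x (Suc m)" "shift (Suc (Suc m)) x"] by (simp add: build_suffix)
    finally have "shift (Suc n) (subst_inf f x) =
        drop 0 (f (x (Suc m))) \<frown> subst_inf f (shift (Suc (Suc m)) x)"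
      by (simp only: drop_0)
    then show ?thesis using marked_nonempty[OF assms] by blast
  qed
qed

text \<open>A coinductive principle: if the image of a letter can be split off from every word of
  \<open>S\<close> with the rest in \<open>S\<close> again, the letters split off successively form
  a preimage.\<close>

lemma desubstitute:
  assumes m: "marked f" and step: "\<And>v. v \<in> S \<Longrightarrow> \<exists>c v'. v = f c \<frown> v' \<and> v' \<in> S" and v: "v \<in> S"
  shows "\<exists>y. v = subst_inf f y"
proof -
  obtain C N where CN: "\<And>v. v \<in> S \<Longrightarrow> v = f (C v) \<frown> N v \<and> N v \<in> S"
    using step by metis
  define V where "V n = (N ^^ n) v" for n
  have VS: "V n \<in> S" for n
    by (induction n) (auto simp: V_def v CN)
  define y where "y n = C (V n)" for n
  have V: "V k n = subst_inf f (shift k y) n" for n k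
  proof (induction n arbitrary: k rule: less_induct)
    case (less n)
    have 1: "V k = f (y k) \<frown> V (Suc k)"
      using CN[OF VS[of k]] by (simp add: y_def V_def)
    have 2: "subst_inf f (shift k y) = f (y k) \<frown> subst_inf f (shift (Suc k) y)"
      using subst_inf_build[OF m, of "y k" "shift (Suc k) y"] by (simp add: build_suffix)
    show ?case
    proof (cases "n < length (f (y k))")
      case False
      have "n - length (f (y k)) < n" using marked_hd[OF m, of "y k"] False by (cases "f (y k)") auto
      from less.IH[OF this] show ?thesis unfolding 1 2 using False by (simp only: conc_snd not_False_eq_True)
    qed (simp only: 1 2 conc_fst)
  qed
  have "V 0 = subst_inf f (shift 0 y)" by (rule HOL.ext) (rule V)
  then have "v = subst_inf f y" by (simp add: V_def)
  then show ?thesis by blast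
qed

section \<open>The elementary substitutions\<close>

definition sL :: substitution where "sL c = (if c then [True, False] else [False])"
definition sR :: substitution where "sR c = (if c then [True] else [False, True])"
definition sT :: substitution where "sT c = (if c then [True, False] else [False, True])"

lemma marked_elem [simp, intro]: "marked sL" "marked sR" "marked sT"
  by (auto simp: marked_def sL_def sR_def sT_def)

lemma subst_inf_elem [simp]:
  "subst_inf sL (True ## x) = True ## False ## subst_inf sL x"
  "subst_inf sL (False ## x) = False ## subst_inf sL x"
  "subst_inf sR (True ## x) = True ## subst_inf sR x"
  "subst_inf sR (False ## x) = False ## True ## subst_inf sR x"
  "subst_inf sT (True ## x) = True ## False ## subst_inf sT x"
  "subst_inf sT (False ## x) = False ## True ## subst_inf sT x"
  by (simp_all add: subst_inf_build, simp_all add: sL_def sR_def sT_def)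

text \<open>Generators are added on the left, so induction peels off the outermost substitution, the
  one whose image is the word at hand.\<close>

inductive submonoid :: "substitution set \<Rightarrow> substitution \<Rightarrow> bool" for S where
  id: "submonoid S subst_id"
| step: "g \<in> S \<Longrightarrow> submonoid S f \<Longrightarrow> submonoid S (g \<odot> f)"

abbreviation "LR \<equiv> submonoid {sL, sR}"
abbreviation "LRT \<equiv> submonoid {sL, sR, sT}"

lemma submonoid_comp: "submonoid S f \<Longrightarrow> submonoid S g \<Longrightarrow> submonoid S (f \<odot> g)"
  by (induction rule: submonoid.induct) (auto simp: subst_comp_assoc intro: submonoid.intros)

lemma submonoid_elem: "g \<in> S \<Longrightarrow> submonoid S g"
  using submonoid.step[OF _ submonoid.id] by force

lemma submonoid_mono: "submonoid S f \<Longrightarrow> S \<subseteq> S' \<Longrightarrow> submonoid S' f"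
  by (induction rule: submonoid.induct) (auto intro: submonoid.intros)

lemma LRT_marked: "LRT f \<Longrightarrow> marked f"
  by (induction rule: submonoid.induct) auto

lemma LR_LRT: "LR f \<Longrightarrow> LRT f"
  by (erule submonoid_mono) auto

lemma LR_marked: "LR f \<Longrightarrow> marked f"
  by (simp add: LRT_marked LR_LRT)

lemma LRT_elem [simp]: "LRT sL" "LRT sR" "LRT sT"
  by (auto intro: submonoid_elem)

section \<open>Words all of whose shifts avoid a hole\<close>

text \<open>The combinatorial survivor set. It is used with \<open>\<alpha>\<close> starting with 0
  and \<open>\<beta>\<close> starting with 1, so the first letter of a tail tells on which side of
  the hole it must lie.\<close>

definition avoid :: "bool word \<Rightarrow> bool word \<Rightarrow> bool word set" where
  "avoid \<alpha> \<beta> = {w. \<forall>n. (\<not> w n \<longrightarrow> shift n w \<sqsubseteq> \<alpha>) \<and> (w n \<longrightarrow> \<beta> \<sqsubseteq> shift n w)}"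

definition eventually_const :: "bool word set" where
  "eventually_const = {w. \<exists>n c. shift n w = (\<lambda>_. c)}"

lemma countable_suffix_in:
  assumes "countable S"
  shows "countable {w :: bool word. \<exists>n. shift n w \<in> S}"
proof (rule countable_subset)
  show "{w. \<exists>n. shift n w \<in> S} \<subseteq> (\<lambda>(u, x). u \<frown> x) ` (UNIV \<times> S)"
    by (force intro: image_eqI[where x = "(initial n w, shift n w)" for n w])
  show "countable ((\<lambda>(u, x). u \<frown> x) ` ((UNIV :: bool list set) \<times> S))"
    using assms by auto
qed

lemma countable_eventually_const: "countable eventually_const"
  using countable_suffix_in[of "range (\<lambda>c _. c)"]
  by (rule countable_subset[rotated]) (auto simp: eventually_const_def)

lemma suffix_unfold2: "shift n w = w n ## w (Suc n) ## shift (Suc (Suc n)) w"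
  by (simp only: build_suffix)

lemma ones_unfold: "\<one>\<^sup>\<omega> = True ## \<one>\<^sup>\<omega>" and zeros_unfold: "\<zero>\<^sup>\<omega> = False ## \<zero>\<^sup>\<omega>"
  by (simp_all add: build_const)

text \<open>The bound starts with 010, so 011 never occurs. Hence from a 0 onwards there is no 11,
  and the word splits into the blocks 0 and 10.\<close>

lemma desubstitute_L:
  assumes w: "\<And>n. \<not> w n \<Longrightarrow> shift n w \<sqsubseteq> subst_inf sL (False ## \<one>\<^sup>\<omega>)"
    and k: "\<not> w k"
  shows "\<exists>y. shift k w = subst_inf sL y"
proof (rule desubstitute[where S = "{v. \<forall>n. \<not> (v n \<and> v (Suc n))}"])
  have *: "subst_inf sL (False ## \<one>\<^sup>\<omega>) = False ## True ## False ## subst_inf sL \<one>\<^sup>\<omega>"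
    by (simp, subst ones_unfold, simp)
  have "\<not> (w (k + n) \<and> w (Suc (k + n)))" for n
  proof (induction n)
    case (Suc n)
    show ?case
    proof
      assume a: "w (k + Suc n) \<and> w (Suc (k + Suc n))"
      then have n: "\<not> w (k + n)" using Suc by auto
      show False using w[OF n] a n unfolding * by auto
    qed
  qed (use k in auto)
  then show "shift k w \<in> {v. \<forall>n. \<not> (v n \<and> v (Suc n))}" by auto
next
  fix v :: "bool word" assume v: "v \<in> {v. \<forall>n. \<not> (v n \<and> v (Suc n))}"
  have closed: "shift m v \<in> {v. \<forall>n. \<not> (v n \<and> v (Suc n))}" for m using v by auto
  show "\<exists>c v'. v = sL c \<frown> v' \<and> v' \<in> {v. \<forall>n. \<not> (v n \<and> v (Suc n))}"
  proof (cases "v 0")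
    case True
    have hd: "v 0 = True" "v (Suc 0) = False" using v True by auto
    have "v = v 0 ## v (Suc 0) ## shift 2 v"
      using suffix_unfold2[of 0 v] by (simp only: suffix_0 numeral_2_eq_2)
    also have "\<dots> = True ## False ## shift 2 v" unfolding hd by (rule refl)
    finally have "v = sL True \<frown> shift 2 v" by (simp only: sL_def if_True if_False build_cons conc_empty)
    then show ?thesis using closed by blast
  next
    case False
    then have "v = sL False \<frown> shift 1 v"
      using build_suffix[of v 0] by (auto simp: sL_def)
    then show ?thesis using closed by blast
  qed
qed auto

text \<open>The bound starts with 101, so 100 never occurs. Hence from a 1 onwards there is no 00,
  and the word splits into the blocks 01 and 1.\<close>

lemma desubstitute_R:
  assumes w: "\<And>n. w n \<Longrightarrow> subst_inf sR (True ## \<zero>\<^sup>\<omega>) \<sqsubseteq> shift n w"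
    and k: "w k"
  shows "\<exists>y. shift k w = subst_inf sR y"
proof (rule desubstitute[where S = "{v. \<forall>n. v n \<or> v (Suc n)}"])
  have *: "subst_inf sR (True ## \<zero>\<^sup>\<omega>) = True ## False ## True ## subst_inf sR \<zero>\<^sup>\<omega>"
    by (simp, subst zeros_unfold, simp)
  have "w (k + n) \<or> w (Suc (k + n))" for n
  proof (induction n)
    case (Suc n)
    show ?case
    proof (rule ccontr)
      assume a: "\<not> (w (k + Suc n) \<or> w (Suc (k + Suc n)))"
      then have n: "w (k + n)" using Suc by auto
      show False using w[OF n] a n unfolding * by auto
    qed
  qed (use k in auto)
  then show "shift k w \<in> {v. \<forall>n. v n \<or> v (Suc n)}" by auto
next
  fix v :: "bool word" assume v: "v \<in> {v. \<forall>n. v n \<or> v (Suc n)}"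
  have closed: "shift m v \<in> {v. \<forall>n. v n \<or> v (Suc n)}" for m using v by auto
  show "\<exists>c v'. v = sR c \<frown> v' \<and> v' \<in> {v. \<forall>n. v n \<or> v (Suc n)}"
  proof (cases "v 0")
    case False
    have hd: "v 0 = False" "v (Suc 0) = True" using v False by auto
    have "v = v 0 ## v (Suc 0) ## shift 2 v"
      using suffix_unfold2[of 0 v] by (simp only: suffix_0 numeral_2_eq_2)
    also have "\<dots> = False ## True ## shift 2 v" unfolding hd by (rule refl)
    finally have "v = sR False \<frown> shift 2 v" by (simp only: sR_def if_True if_False build_cons conc_empty)
    then show ?thesis using closed by blast
  next
    case True
    then have "v = sR True \<frown> shift 1 v"
      using build_suffix[of v 0] by (auto simp: sR_def)
    then show ?thesis using closed by blast
  qed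
qed auto

text \<open>Tails between 0101... and 1010... split off a block 01 or 10 with the remainder in the
  same range. It remains to find one tail in this range.\<close>

lemma desubstitute_T:
  assumes w0: "\<And>n. \<not> w n \<Longrightarrow> shift n w \<sqsubseteq> subst_inf sT (False ## \<one>\<^sup>\<omega>)"
    and w1: "\<And>n. w n \<Longrightarrow> subst_inf sT (True ## \<zero>\<^sup>\<omega>) \<sqsubseteq> shift n w"
    and nc: "w \<notin> eventually_const"
  shows "\<exists>k y. shift k w = subst_inf sT y"
proof -
  define A where "A = subst_inf sT \<zero>\<^sup>\<omega>"
  define B where "B = subst_inf sT \<one>\<^sup>\<omega>"
  have A: "A = False ## True ## A" unfolding A_def by (subst zeros_unfold, simp)
  have B: "B = True ## False ## B" unfolding B_def by (subst ones_unfold, simp)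
  have w0: "\<not> w n \<Longrightarrow> shift n w \<sqsubseteq> False ## True ## B"
    and w1: "w n \<Longrightarrow> True ## False ## A \<sqsubseteq> shift n w" for n
    using w0 w1 by (auto simp: A_def B_def)
  define P where "P v \<longleftrightarrow> A \<sqsubseteq> v \<and> v \<sqsubseteq> B" for v
  let ?S = "{shift n w |n. P (shift n w)}"
  have step: "\<exists>c v'. v = sT c \<frown> v' \<and> v' \<in> ?S" if v: "v \<in> ?S" for v
  proof -
    obtain n where n: "v = shift n w" "P v" using v by auto
    have v2: "v = w n ## w (Suc n) ## shift (Suc (Suc n)) w"
      unfolding n by (rule suffix_unfold2)
    show ?thesis
    proof (cases "w n")
      case False
      then have "False ## True ## A \<sqsubseteq> v"
        using n(2) A unfolding P_def by metis
      then have a: "w (Suc n)" "A \<sqsubseteq> shift (Suc (Suc n)) w" using False n by auto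
      have "shift (Suc (Suc n)) w \<sqsubseteq> B" using w0[OF False] a False by auto
      then have "P (shift (Suc (Suc n)) w)" using a unfolding P_def by auto
      moreover have "v = sT False \<frown> shift (Suc (Suc n)) w"
        using a False by (subst v2) (auto simp: sT_def)
      ultimately show ?thesis by blast
    next
      case True
      then have "v \<sqsubseteq> True ## False ## B"
        using n(2) B unfolding P_def by metis
      then have a: "\<not> w (Suc n)" "shift (Suc (Suc n)) w \<sqsubseteq> B" using True n by auto
      have "A \<sqsubseteq> shift (Suc (Suc n)) w" using w1[OF True] a True by auto
      then have "P (shift (Suc (Suc n)) w)" using a unfolding P_def by auto
      moreover have "v = sT True \<frown> shift (Suc (Suc n)) w"
        using a True by (subst v2) (auto simp: sT_def)
      ultimately show ?thesis by blast
    qed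
  qed
  \<comment> \<open>For a tail starting with 0 the upper bound is automatic, for one starting with 1
    the lower bound is.\<close>
  have P1: "P (shift n w)" if "\<not> w n" "A \<sqsubseteq> shift n w" for n
    using that unfolding P_def by (subst B) auto
  have P2: "P (shift n w)" if "w n" "shift n w \<sqsubseteq> B" for n
    using that unfolding P_def by (subst A) auto
  have ex1: "\<exists>k\<ge>n. w k" and ex0: "\<exists>k\<ge>n. \<not> w k" for n
    using nc unfolding eventually_const_def fun_eq_iff
    by (simp_all, (metis le_add1 suffix_nth)+)
  \<comment> \<open>After 10 a tail is at least \<open>A\<close>, so the last 0 of a factor 100
    starts a suitable tail; the last 1 of a factor 011 does so likewise. If neither factor occurs,
    the word finally alternates and some tail equals \<open>A\<close>.\<close>
  have "\<exists>k. P (shift k w)"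
  proof (cases "\<exists>n. w n \<and> \<not> w (Suc n) \<and> \<not> w (Suc (Suc n))")
    case True
    then obtain n where n: "w n" "\<not> w (Suc n)" "\<not> w (Suc (Suc n))" by blast
    have "A \<sqsubseteq> shift (Suc (Suc n)) w"
      using w1[OF n(1)] n by auto
    then show ?thesis using P1 n by blast
  next
    case no100: False
    show ?thesis
    proof (cases "\<exists>n. \<not> w n \<and> w (Suc n) \<and> w (Suc (Suc n))")
      case True
      then obtain n where n: "\<not> w n" "w (Suc n)" "w (Suc (Suc n))" by blast
      have "shift (Suc (Suc n)) w \<sqsubseteq> B"
        using w0[OF n(1)] n by auto
      then show ?thesis using P2 n by blast
    next
      case no011: False
      obtain j where j: "w j" using ex1 by blast
      have ex: "\<exists>k\<ge>j. \<not> w k" by (rule ex0)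
      define k where "k = (LEAST k. k \<ge> j \<and> \<not> w k)"
      have k: "k \<ge> j" "\<not> w k" using LeastI_ex[of "\<lambda>k. k \<ge> j \<and> \<not> w k"] ex unfolding k_def by auto
      have "k \<noteq> j" using j k by auto
      then have k1: "k = Suc (k - 1)" "k - 1 \<ge> j" using k by auto
      have "w (k - 1)" using not_less_Least[of "k - 1" "\<lambda>k. k \<ge> j \<and> \<not> w k"] k1
        unfolding k_def[symmetric] by auto
      then have base: "w (Suc k)" using no100 k k1 by metis
      have alt: "\<not> w (k + 2 * n) \<and> w (Suc (k + 2 * n))" for n
      proof (induction n)
        case (Suc n)
        have "\<not> w (Suc (Suc (k + 2 * n)))" using Suc no011 by blast
        moreover from this have "w (Suc (Suc (Suc (k + 2 * n))))" using Suc no100 by blast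
        ultimately show ?case by simp
      qed (use k base in auto)
      have "shift k w = A"
      proof -
        have "shift k w = [False, True] \<frown> shift k w"
        proof
          fix i
          show "shift k w i = ([False, True] \<frown> shift k w) i"
          proof (cases "even i")
            case True
            then obtain m where "i = 2 * m" by blast
            then show ?thesis using alt[of m] alt[of "m - 1"] alt[of 0] by (cases m) auto
          next
            case False
            then obtain m where "i = 2 * m + 1" using oddE by blast
            then show ?thesis using alt[of m] alt[of "m - 1"] alt[of 0] by (cases m) auto
          qed
        qed
        moreover have "A = [False, True] \<frown> A" using A by simp
        ultimately show ?thesis by (metis iter_unique list.distinct(1))
      qed
      then have "P (shift k w)" using P1[OF k(2)] by simp
      then show ?thesis by blast
    qed
  qed
  then obtain k where "P (shift k w)" by blast
  then have "shift k w \<in> ?S" by auto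
  from desubstitute[of sT ?S, OF _ step this] show ?thesis by blast
qed

lemma desubstitute_elem:
  assumes g: "g \<in> {sL, sR, sT}" and nc: "w \<notin> eventually_const"
    and w: "w \<in> avoid (subst_inf g (False ## \<alpha>)) (subst_inf g (True ## \<beta>))"
  obtains n y where "shift n w = subst_inf g y"
proof -
  have m: "marked g" using g by auto
  \<comment> \<open>The constraints are weakest when \<open>\<alpha>\<close> is all ones and
    \<open>\<beta>\<close> all zeros, and the three desubstitution lemmas are stated for these
    bounds.\<close>
  have "subst_inf g (False ## \<alpha>) \<sqsubseteq> subst_inf g (False ## \<one>\<^sup>\<omega>)"
    "subst_inf g (True ## \<zero>\<^sup>\<omega>) \<sqsubseteq> subst_inf g (True ## \<beta>)"
    by (intro subst_inf_le[OF m], simp)+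
  then have w01: "\<not> w n \<Longrightarrow> shift n w \<sqsubseteq> subst_inf g (False ## \<one>\<^sup>\<omega>)"
    "w n \<Longrightarrow> subst_inf g (True ## \<zero>\<^sup>\<omega>) \<sqsubseteq> shift n w" for n
    using w unfolding avoid_def by (blast intro: lex_le_trans)+
  have ex: "\<exists>k. w k = c" for c
  proof (rule ccontr)
    assume "\<not> ?thesis"
    then have "shift 0 w = (\<lambda>_. \<not> c)" by (auto simp: fun_eq_iff)
    then show False using nc unfolding eventually_const_def by blast
  qed
  from g consider "g = sL" | "g = sR" | "g = sT" by blast
  then show ?thesis
  proof cases
    case 1
    then show ?thesis using desubstitute_L[of w] w01 ex[of False] that by blast
  next
    case 2
    then show ?thesis using desubstitute_R[of w] w01 ex[of True] that by blast
  next
    case 3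
    then show ?thesis using desubstitute_T[of w] w01 nc that by blast
  qed
qed

text \<open>Unless it is eventually constant, an avoiding word has a tail
  \<open>subst_inf g y\<close>. As \<open>g\<close> preserves and reflects the order and keeps first
  letters, \<open>y\<close> avoids the original hole; the prefix in front adds only countably many
  choices.\<close>

lemma countable_avoid_subst:
  assumes g: "g \<in> {sL, sR, sT}" and c: "countable (avoid (False ## \<alpha>) (True ## \<beta>))"
  shows "countable (avoid (subst_inf g (False ## \<alpha>)) (subst_inf g (True ## \<beta>)))"
proof (rule countable_subset)
  let ?S = "subst_inf g ` avoid (False ## \<alpha>) (True ## \<beta>)"
  show "avoid (subst_inf g (False ## \<alpha>)) (subst_inf g (True ## \<beta>)) \<subseteq>
      eventually_const \<union> {w. \<exists>n. shift n w \<in> ?S}"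
  proof
    fix w assume w: "w \<in> avoid (subst_inf g (False ## \<alpha>)) (subst_inf g (True ## \<beta>))"
    show "w \<in> eventually_const \<union> {w. \<exists>n. shift n w \<in> ?S}"
    proof (cases "w \<in> eventually_const")
      case False
      obtain n y where y: "shift n w = subst_inf g y"
        using desubstitute_elem[OF g False w] by blast
      have m: "marked g" using g by auto
      have hd: "subst_inf g (c ## x) 0 = c" for c x
        using marked_hd[OF m, of c] by (metis subst_inf_build[OF m] build_cons build.simps(1))
      have "y \<in> avoid (False ## \<alpha>) (True ## \<beta>)"
        unfolding avoid_def
      proof (intro CollectI allI)
        fix k
        obtain j where j: "shift j (subst_inf g y) = subst_inf g (shift k y)"
          using suffix_subst_inf[OF m] by blast
        have s: "shift (n + j) w = subst_inf g (shift k y)"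
          using y j by (metis suffix_suffix)
        have "w (n + j) = y k"
        proof -
          have "w (n + j) = subst_inf g (shift k y) 0" using s by (metis add_0_right suffix_nth)
          then show ?thesis using hd[of "y k" "shift (Suc k) y"] by (simp add: build_suffix)
        qed
        moreover have "(\<not> w (n + j) \<longrightarrow> shift (n + j) w \<sqsubseteq> subst_inf g (False ## \<alpha>)) \<and>
            (w (n + j) \<longrightarrow> subst_inf g (True ## \<beta>) \<sqsubseteq> shift (n + j) w)"
          using w unfolding avoid_def by blast
        ultimately show "(\<not> y k \<longrightarrow> shift k y \<sqsubseteq> False ## \<alpha>) \<and> (y k \<longrightarrow> True ## \<beta> \<sqsubseteq> shift k y)"
          unfolding s by (simp add: subst_inf_le_iff[OF m])
      qed
      then show ?thesis using y by blast
    qed simp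
  qed
  show "countable (eventually_const \<union> {w. \<exists>n. shift n w \<in> ?S})"
    using countable_suffix_in[of ?S] countable_eventually_const c by auto
qed

lemma LRT_build:
  assumes "LRT f"
  obtains y where "subst_inf f (c ## x) = c ## y"
  using marked_hd[OF LRT_marked[OF assms], of c] that
  by (metis subst_inf_build[OF LRT_marked[OF assms]] build_cons)

lemma countable_avoid_LRT:
  assumes "LRT f" and "countable (avoid (False ## \<alpha>) (True ## \<beta>))"
  shows "countable (avoid (subst_inf f (False ## \<alpha>)) (subst_inf f (True ## \<beta>)))"
  using assms
proof (induction rule: submonoid.induct)
  case (step g f)
  obtain y y' where "subst_inf f (False ## \<alpha>) = False ## y" "subst_inf f (True ## \<beta>) = True ## y'"
    using LRT_build[OF step.hyps(2)] by metis
  then show ?case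
    using step countable_avoid_subst[OF step.hyps(1)]
    by (auto simp: subst_inf_comp LRT_marked)
qed simp

section \<open>Countability for the two extreme holes\<close>

lemma countable_avoid_base1: "countable (avoid (False ## True ## \<zero>\<^sup>\<omega>) (True ## \<zero>\<^sup>\<omega>))"
proof (rule countable_subset[OF _ countable_eventually_const], rule subsetI, rule ccontr)
  fix w assume w: "w \<in> avoid (False ## True ## \<zero>\<^sup>\<omega>) (True ## \<zero>\<^sup>\<omega>)" and nc: "w \<notin> eventually_const"
  have ex1: "\<exists>k\<ge>n. w k" and ex0: "\<exists>k\<ge>n. \<not> w k" for n
    using nc unfolding eventually_const_def fun_eq_iff
    by (simp_all, (metis le_add1 suffix_nth)+)
  obtain j where j: "\<not> w j" using ex0 by blast
  define k where "k = (LEAST k. k \<ge> j \<and> w k)"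
  have k: "k \<ge> j" "w k" using LeastI_ex[of "\<lambda>k. k \<ge> j \<and> w k"] ex1 unfolding k_def by auto
  have "k \<noteq> j" using j k by auto
  then have k1: "k = Suc (k - 1)" "k - 1 \<ge> j" using k by auto
  have nk: "\<not> w (k - 1)" using not_less_Least[of "k - 1" "\<lambda>k. k \<ge> j \<and> w k"] k1
    unfolding k_def[symmetric] by auto
  \<comment> \<open>A 0 followed by a 1 can only be continued by zeros.\<close>
  have "shift (k - 1) w \<sqsubseteq> False ## True ## \<zero>\<^sup>\<omega>" using w nk unfolding avoid_def by blast
  then have "shift (Suc k) w \<sqsubseteq> \<zero>\<^sup>\<omega>" using nk k k1 by auto
  then have "shift (Suc k) w = \<zero>\<^sup>\<omega>"
    using lex_not_le zeros_lex_le unfolding lex_le_def by blast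
  then show False using nc unfolding eventually_const_def by blast
qed

lemma countable_avoid_base2: "countable (avoid (False ## \<one>\<^sup>\<omega>) (True ## False ## \<one>\<^sup>\<omega>))"
proof (rule countable_subset[OF _ countable_eventually_const], rule subsetI, rule ccontr)
  fix w assume w: "w \<in> avoid (False ## \<one>\<^sup>\<omega>) (True ## False ## \<one>\<^sup>\<omega>)" and nc: "w \<notin> eventually_const"
  have ex1: "\<exists>k\<ge>n. w k" and ex0: "\<exists>k\<ge>n. \<not> w k" for n
    using nc unfolding eventually_const_def fun_eq_iff
    by (simp_all, (metis le_add1 suffix_nth)+)
  obtain j where j: "w j" using ex1 by blast
  define k where "k = (LEAST k. k \<ge> j \<and> \<not> w k)"
  have k: "k \<ge> j" "\<not> w k" using LeastI_ex[of "\<lambda>k. k \<ge> j \<and> \<not> w k"] ex0 unfolding k_def by auto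
  have "k \<noteq> j" using j k by auto
  then have k1: "k = Suc (k - 1)" "k - 1 \<ge> j" using k by auto
  have nk: "w (k - 1)" using not_less_Least[of "k - 1" "\<lambda>k. k \<ge> j \<and> \<not> w k"] k1
    unfolding k_def[symmetric] by auto
  \<comment> \<open>Here a 1 followed by a 0 can only be continued by ones.\<close>
  have "True ## False ## \<one>\<^sup>\<omega> \<sqsubseteq> shift (k - 1) w" using w nk unfolding avoid_def by blast
  then have "\<one>\<^sup>\<omega> \<sqsubseteq> shift (Suc k) w" using nk k k1 by auto
  then have "shift (Suc k) w = \<one>\<^sup>\<omega>"
    using lex_not_le lex_le_ones unfolding lex_le_def by blast
  then show False using nc unfolding eventually_const_def by blast
qed

section \<open>Images that stay outside a hole\<close>

definition trapped :: "bool word \<Rightarrow> bool word \<Rightarrow> bool word \<Rightarrow> bool" where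
  "trapped \<alpha> \<beta> u \<longleftrightarrow> (\<forall>n. False ## shift n u \<sqsubseteq> \<alpha> \<and> \<beta> \<sqsubseteq> True ## shift n u)"

text \<open>\<open>trapped\<close> puts both letters in front of every tail, because a tail of the
  image may start inside a block. The extended tail is either the image of an extended tail of
  \<open>u\<close>, or it differs from the bound within three letters, as the bounds start with 01
  and 10 before \<open>g\<close> is applied.\<close>

lemma trapped_subst:
  assumes g: "g \<in> {sL, sR, sT}" and t: "trapped (False ## True ## \<alpha>) (True ## False ## \<beta>) u"
  shows "trapped (subst_inf g (False ## True ## \<alpha>)) (subst_inf g (True ## False ## \<beta>)) (subst_inf g u)"
  unfolding trapped_def
proof
  fix n
  have m: "marked g" using g by auto
  obtain k j where j: "j < length (g (u k))"
    and s: "shift n (subst_inf g u) = drop j (g (u k)) \<frown> subst_inf g (shift (Suc k) u)"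
    using suffix_subst_inf_cases[OF m] by blast
  have le: "subst_inf g (False ## shift i u) \<sqsubseteq> subst_inf g (False ## True ## \<alpha>)"
    "subst_inf g (True ## False ## \<beta>) \<sqsubseteq> subst_inf g (True ## shift i u)" for i
    using t unfolding trapped_def by (auto intro!: subst_inf_le[OF m])
  note le' = le[of k] le[of "Suc k"]
  have k: "shift k u = u k ## shift (Suc k) u" by (simp add: build_suffix)
  have k2: "shift (Suc k) u = u (Suc k) ## shift (Suc (Suc k)) u" by (simp add: build_suffix)
  have ub: "False ## shift i u \<sqsubseteq> False ## True ## \<alpha>" "True ## False ## \<beta> \<sqsubseteq> True ## shift i u" for i
    using t unfolding trapped_def by auto
  consider "g = sL" | "g = sR" | "g = sT" using g by blast
  then show "False ## shift n (subst_inf g u) \<sqsubseteq> subst_inf g (False ## True ## \<alpha>) \<and>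
      subst_inf g (True ## False ## \<beta>) \<sqsubseteq> True ## shift n (subst_inf g u)"
  proof cases
    case 1
    then have "j = 0 \<or> (u k \<and> j = 1)" using j by (auto simp: sL_def split: if_splits)
    then show ?thesis using le' 1 unfolding s k
      by (cases "u k"; cases "u (Suc k)") (auto simp: sL_def k2)
  next
    case 2
    then have "j = 0 \<or> (\<not> u k \<and> j = 1)" using j by (auto simp: sR_def split: if_splits)
    then show ?thesis using le' 2 unfolding s k
      by (cases "u k"; cases "u (Suc k)") (auto simp: sR_def k2)
  next
    case 3
    then have "j = 0 \<or> j = 1" using j by (auto simp: sT_def split: if_splits)
    then show ?thesis using le' 3 unfolding s k
      by (cases "u k"; cases "u (Suc k)") (auto simp: sT_def k2)
  qed
qed

lemma LRT_build2:
  assumes "LRT f"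
  shows "(\<exists>y. subst_inf f (False ## True ## x) = False ## True ## y) \<and>
    (\<exists>y. subst_inf f (True ## False ## x) = True ## False ## y)"
  using assms
proof (induction rule: submonoid.induct)
  case (step g f)
  then obtain y y' where "subst_inf f (False ## True ## x) = False ## True ## y"
    "subst_inf f (True ## False ## x) = True ## False ## y'" by blast
  with step.hyps show ?case by (auto simp: subst_inf_comp LRT_marked)
qed auto

lemma trapped_LRT:
  assumes "LRT f"
  shows "trapped (subst_inf f (False ## \<one>\<^sup>\<omega>)) (subst_inf f (True ## \<zero>\<^sup>\<omega>)) (subst_inf f w)"
  using assms
proof (induction rule: submonoid.induct)
  case id
  then show ?case by (simp add: trapped_def)
next
  case (step g f)
  have m: "marked g" "marked f" using step.hyps LRT_marked by auto
  \<comment> \<open>Writing the constant parts with one more letter exposes the second letters 1 and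
    0 on which \<open>trapped_subst\<close> relies.\<close>
  have "subst_inf f (False ## \<one>\<^sup>\<omega>) = subst_inf f (False ## True ## \<one>\<^sup>\<omega>)"
    "subst_inf f (True ## \<zero>\<^sup>\<omega>) = subst_inf f (True ## False ## \<zero>\<^sup>\<omega>)"
    by (simp_all add: build_const)
  then obtain \<alpha> \<beta> where ab: "subst_inf f (False ## \<one>\<^sup>\<omega>) = False ## True ## \<alpha>"
    "subst_inf f (True ## \<zero>\<^sup>\<omega>) = True ## False ## \<beta>"
    using LRT_build2[OF step.hyps(2)] by metis
  then show ?case
    using trapped_subst[OF step.hyps(1), of \<alpha> \<beta> "subst_inf f w"] step.IH m
    by (simp add: subst_inf_comp)
qed

section \<open>Balanced words\<close>

lemma ones_simps [simp]: "ones [] = 0" "ones (c # w) = of_bool c + ones w"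
  "ones (u @ v) = ones u + ones v"
  by (auto simp: ones_def)

lemma ones_le_length: "ones w \<le> length w"
  by (auto simp: ones_def count_le_length)

lemma ones_map_Not: "ones (map Not w) = length w - ones w"
proof -
  have "ones (map Not w) + ones w = length w" by (induction w) auto
  then show ?thesis by simp
qed

text \<open>At the first difference \<open>w\<close> must carry the 0, since otherwise its prefix
  would contain one more 1.\<close>

lemma list_le_of_ones_le:
  fixes w s :: "bool list"
  assumes "length w = length s" "\<And>k. k < length w \<Longrightarrow> ones (take (Suc k) w) \<le> ones (take (Suc k) s)"
  shows "w \<le> s"
  using assms
proof (induction w s rule: list_induct2)
  case (Cons c w d s)
  show ?case
  proof (cases "c = d")
    case True
    have "w \<le> s" using Cons.prems[of "Suc k" for k] True by (intro Cons.IH) auto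
    then show ?thesis using True by simp
  next
    case False
    then have "\<not> c \<and> d" using Cons.prems[of 0] by auto
    then show ?thesis by simp
  qed
qed simp

lemma map_Not_le:
  fixes u v :: "bool list"
  assumes "length u = length v"
  shows "map Not u \<le> map Not v \<longleftrightarrow> v \<le> u"
  using assms by (induction u v rule: list_induct2) auto

lemma map_Not_Not [simp]: "map Not (map Not w) = w"
  by (induction w) auto

lemma sublist_iff_take_drop:
  "sublist u w \<longleftrightarrow> (\<exists>i k. i + k \<le> length w \<and> u = take k (drop i w))"
proof
  assume "sublist u w"
  then obtain a b where "w = a @ u @ b" unfolding sublist_def by blast
  then show "\<exists>i k. i + k \<le> length w \<and> u = take k (drop i w)"
    by (intro exI[of _ "length a"] exI[of _ "length u"]) auto
next
  assume "\<exists>i k. i + k \<le> length w \<and> u = take k (drop i w)"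
  then show "sublist u w" by (metis sublist_drop sublist_order.order_trans sublist_take)
qed

text \<open>Factors are given by positions, and one inequality is enough because \<open>i\<close>
  and \<open>j\<close> may be exchanged.\<close>

lemma balanced_alt:
  "balanced w \<longleftrightarrow> (\<forall>i j k. i + k \<le> length w \<and> j + k \<le> length w \<longrightarrow>
     ones (take k (drop i w)) \<le> Suc (ones (take k (drop j w))))" (is "_ \<longleftrightarrow> ?R")
proof
  assume b: "balanced w"
  show ?R
  proof (intro allI impI)
    fix i j k assume a: "i + k \<le> length w \<and> j + k \<le> length w"
    then have "sublist (take k (drop i w)) w" "sublist (take k (drop j w)) w"
      unfolding sublist_iff_take_drop by blast+
    then have "\<bar>int (ones (take k (drop i w))) - int (ones (take k (drop j w)))\<bar> \<le> 1"
      using b a unfolding balanced_def by auto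
    then show "ones (take k (drop i w)) \<le> Suc (ones (take k (drop j w)))" by linarith
  qed
next
  assume r: ?R
  show "balanced w"
    unfolding balanced_def
  proof (intro allI impI)
    fix u v assume a: "sublist u w \<and> sublist v w \<and> length u = length v"
    then obtain i k j l where *: "i + k \<le> length w" "u = take k (drop i w)"
      "j + l \<le> length w" "v = take l (drop j w)" unfolding sublist_iff_take_drop by metis
    then have "l = k" using a by auto
    then have "ones u \<le> Suc (ones v)" "ones v \<le> Suc (ones u)" using r * by metis+
    then show "\<bar>int (ones u) - int (ones v)\<bar> \<le> 1" by linarith
  qed
qed

lemma balanced_map_Not:
  assumes "balanced w"
  shows "balanced (map Not w)"
  unfolding balanced_alt
proof (intro allI impI)
  fix i j k assume a: "i + k \<le> length (map Not w) \<and> j + k \<le> length (map Not w)"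
  have o: "ones (take k (drop l (map Not w))) = k - ones (take k (drop l w))"
    "ones (take k (drop l w)) \<le> k"
    if "l + k \<le> length w" for l
    using that ones_le_length[of "take k (drop l w)"]
    by (auto simp: take_map drop_map ones_map_Not)
  have "ones (take k (drop j w)) \<le> Suc (ones (take k (drop i w)))"
    using assms a unfolding balanced_alt by auto
  then show "ones (take k (drop i (map Not w))) \<le> Suc (ones (take k (drop j (map Not w))))"
    using o[of i] o[of j] a by auto
qed

lemma cyclically_balanced_map_Not: "cyclically_balanced w \<Longrightarrow> cyclically_balanced (map Not w)"
  unfolding cyclically_balanced_def using balanced_map_Not[of "w @ w"] by simp

lemma ones_rotation:
  assumes "l \<le> length w"
  shows "ones (take (length w) (drop l (w @ w))) = ones w"
proof -
  have "take (length w) (drop l (w @ w)) = drop l w @ take l w" using assms by auto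
  moreover have "ones (take l w) + ones (drop l w) = ones w"
    by (metis append_take_drop_id ones_simps(3))
  ultimately show ?thesis by simp
qed

lemma ones_take_drop:
  assumes "l + k \<le> length w"
  shows "ones (take k (drop l w)) = (\<Sum>t<k. of_bool (w ! (l + t)))"
  using assms
proof (induction k)
  case (Suc k)
  then have "take (Suc k) (drop l w) = take k (drop l w) @ [w ! (l + k)]"
    by (simp add: take_Suc_conv_app_nth)
  then show ?case using Suc by simp
qed simp

text \<open>Double counting: each position of the cyclic word lies in exactly \<open>k\<close> of
  the factors.\<close>

lemma sum_ones_factors:
  assumes "k \<le> length w"
  shows "(\<Sum>l<length w. ones (take k (drop l (w @ w)))) = k * ones w"
proof -
  let ?q = "length w"
  have "(\<Sum>l<?q. ones (take k (drop l (w @ w)))) = (\<Sum>l<?q. \<Sum>t<k. of_bool ((w @ w) ! (l + t)))"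
    using assms by (intro sum.cong refl ones_take_drop) auto
  also have "\<dots> = (\<Sum>t<k. \<Sum>l<?q. of_bool ((w @ w) ! (t + l)))"
    by (subst sum.swap) (simp add: add.commute)
  also have "\<dots> = (\<Sum>t<k. ones (take ?q (drop t (w @ w))))"
    using assms by (intro sum.cong refl ones_take_drop[symmetric]) auto
  also have "\<dots> = (\<Sum>t<k. ones w)"
    using assms by (intro sum.cong refl ones_rotation) auto
  finally show ?thesis by simp
qed

text \<open>If one factor had too many ones, all factors of that length would exceed the average.\<close>

lemma cyclically_balanced_factor_bound:
  assumes cb: "cyclically_balanced w" and i: "i < length w" and k: "k \<le> length w"
  shows "length w * ones (take k (drop i (w @ w))) < k * ones w + length w"
proof (rule ccontr)
  let ?c = "\<lambda>l. ones (take k (drop l (w @ w)))" and ?q = "length w"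
  assume "\<not> ?thesis"
  then have big: "k * ones w + ?q \<le> ?q * ?c i" by simp
  have le: "?c i \<le> Suc (?c l)" if "l < ?q" for l
  proof -
    have "i + k \<le> length (w @ w)" "l + k \<le> length (w @ w)" using that i k by auto
    then show ?thesis using cb unfolding cyclically_balanced_def balanced_alt by blast
  qed
  have "?q > 0" using i by auto
  have "?c i > 0" using big \<open>?q > 0\<close> by (metis add_is_0 gr0I le_zero_eq less_irrefl mult_0_right)
  have "(\<Sum>l<?q. ?c i - 1) < (\<Sum>l<?q. ?c l)"
  proof (rule sum_strict_mono_ex1)
    show "\<forall>l\<in>{..<?q}. ?c i - 1 \<le> ?c l" using le by force
    show "\<exists>l\<in>{..<?q}. ?c i - 1 < ?c l" using i \<open>?c i > 0\<close> by (intro bexI[of _ i]) auto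
  qed simp
  then have "?q * (?c i - 1) < k * ones w" using sum_ones_factors[OF k] by simp
  then show False using big \<open>?c i > 0\<close> by (simp add: diff_mult_distrib2)
qed

section \<open>Extremal cyclically balanced words as lattice paths\<close>

definition cyclic_words :: "nat \<Rightarrow> nat \<Rightarrow> bool \<Rightarrow> bool list set" where
  "cyclic_words p q c = {w. cyclically_balanced w \<and> length w = q \<and> ones w = p \<and> hd w = c}"

text \<open>
  The lattice path that starts at \<open>z\<close> zeros and \<open>o'\<close> ones and reads \<open>w\<close> stays in the strip around
  the line of slope \<open>p / m\<close> in which, after \<open>k \<ge> 1\<close> letters, the number of ones is
  \<open>\<lceil>(k - 1) p / (p + m)\<rceil>\<close>.
\<close>

definition in_strip :: "int \<Rightarrow> int \<Rightarrow> int \<Rightarrow> int \<Rightarrow> bool" where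
  "in_strip p m z o' \<longleftrightarrow> (z - 1) * p \<le> m * o' \<and> m * (o' - 1) < z * p"

primrec strip_path :: "int \<Rightarrow> int \<Rightarrow> int \<Rightarrow> int \<Rightarrow> bool list \<Rightarrow> bool" where
  "strip_path p m z o' [] \<longleftrightarrow> in_strip p m z o'"
| "strip_path p m z o' (c # w) \<longleftrightarrow>
     in_strip p m z o' \<and> strip_path p m (z + of_bool (\<not> c)) (o' + of_bool c) w"

lemma strip_path_start: "strip_path p m z o' w \<Longrightarrow> in_strip p m z o'"
  by (cases w) auto

text \<open>The shear sending \<open>(z, o')\<close> to \<open>(z + o', o')\<close> maps the strip
  for \<open>p\<close> and \<open>m\<close> into the one for \<open>p\<close> and
  \<open>m + p\<close>. The only new points lie inside the images 10, and they satisfy the bounds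
  because the ends of the original step do.\<close>

lemma strip_path_L:
  "0 < p \<Longrightarrow> 0 < m \<Longrightarrow> strip_path p m z o' w \<Longrightarrow>
    strip_path p (m + p) (z + o') o' (subst_word sL w)"
proof (induction w arbitrary: z o')
  case Nil
  then show ?case by (auto simp: in_strip_def algebra_simps)
next
  case (Cons c w)
  have "strip_path p m (z + of_bool (\<not> c)) (o' + of_bool c) w" using Cons.prems by simp
  from Cons.IH[OF Cons.prems(1,2) this] strip_path_start[OF this] Cons.prems show ?case
    by (cases c) (auto simp: sL_def in_strip_def algebra_simps)
qed

lemma strip_path_R:
  "0 < p \<Longrightarrow> 0 < m \<Longrightarrow> strip_path p m z o' w \<Longrightarrow>
    strip_path (p + m) m z (o' + z) (subst_word sR w)"
proof (induction w arbitrary: z o')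
  case Nil
  then show ?case by (auto simp: in_strip_def algebra_simps)
next
  case (Cons c w)
  have "strip_path p m (z + of_bool (\<not> c)) (o' + of_bool c) w" using Cons.prems by simp
  from Cons.IH[OF Cons.prems(1,2) this] strip_path_start[OF this] Cons.prems show ?case
    by (cases c) (auto simp: sR_def in_strip_def algebra_simps)
qed

lemma strip_path_take:
  "strip_path p m z o' w \<Longrightarrow> k \<le> length w \<Longrightarrow>
    in_strip p m (z + int k - int (ones (take k w))) (o' + int (ones (take k w)))"
proof (induction w arbitrary: z o' k)
  case (Cons c w)
  show ?case
  proof (cases k)
    case 0
    then show ?thesis using strip_path_start[OF Cons.prems(1)] by simp
  next
    case (Suc j)
    have "strip_path p m (z + of_bool (\<not> c)) (o' + of_bool c) w" using Cons.prems by simp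
    from Cons.IH[OF this, of j] Cons.prems(2) Suc show ?thesis
      by (cases c) (auto simp: algebra_simps)
  qed
qed auto

lemma strip_path_ones:
  assumes "strip_path (int p) (int m) 0 0 w" "k \<le> length w"
  shows "(int k - 1) * int p \<le> int (p + m) * int (ones (take k w))"
    "int (p + m) * int (ones (take k w)) < (int k - 1) * int p + int (p + m)"
  using strip_path_take[OF assms] by (auto simp: in_strip_def algebra_simps)

lemma close_multiples:
  fixes a b q x :: int
  assumes "\<bar>q * a - x\<bar> < q" "\<bar>q * b - x\<bar> < q"
  shows "a \<le> b + 1"
proof -
  have "q * a < q * (b + 2)" using assms by (auto simp: algebra_simps abs_less_iff)
  moreover have "0 < q" using assms by auto
  ultimately show ?thesis by (simp add: mult_less_cancel_left_pos)
qed

text \<open>The strip fixes all prefix counts of \<open>s @ s\<close>. So the number of ones in a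
  factor of length \<open>k\<close>, multiplied by \<open>p + m\<close>, is less than
  \<open>p + m\<close> away from \<open>k * p\<close>, which gives balance. A competitor starts with
  0, and the ones among its next \<open>k\<close> letters obey
  \<open>cyclically_balanced_factor_bound\<close>; \<open>s\<close> attains the largest count
  permitted there.\<close>

lemma strip_path_extremal:
  assumes s: "strip_path (int p) (int m) 0 0 s" and p: "0 < p" and m: "0 < m"
    and len: "length s = p + m" and on: "ones s = p"
  shows "s \<in> cyclic_words p (p + m) False" and "w \<in> cyclic_words p (p + m) False \<Longrightarrow> w \<le> s"
proof -
  let ?q = "p + m"
  have pre: "(int k - 1) * int p \<le> int ?q * int (ones (take k (s @ s)))
      \<and> int ?q * int (ones (take k (s @ s))) < (int k - 1) * int p + int ?q" if k: "k \<le> 2 * ?q" for k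
  proof (cases "k \<le> ?q")
    case True
    then show ?thesis using strip_path_ones[OF s, of k] len by simp
  next
    case False
    \<comment> \<open>Past the first copy the prefix counts repeat with \<open>p\<close> more
      ones.\<close>
    then obtain j where j: "k = ?q + j" by (metis le_Suc_ex nat_le_linear)
    then have "j \<le> ?q" using k by simp
    then show ?thesis using strip_path_ones[OF s, of j] len on j
      by (simp add: algebra_simps)
  qed
  have fac: "\<bar>int ?q * int (ones (take k (drop i (s @ s)))) - int k * int p\<bar> < int ?q"
    if "i + k \<le> 2 * ?q" for i k
  proof -
    have "ones (take (i + k) (s @ s)) = ones (take i (s @ s)) + ones (take k (drop i (s @ s)))"
      by (simp only: take_add ones_simps)
    then have "int ?q * int (ones (take (i + k) (s @ s))) =
        int ?q * int (ones (take i (s @ s))) + int ?q * int (ones (take k (drop i (s @ s))))"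
      by (simp only: of_nat_add distrib_left)
    moreover have "(int (i + k) - 1) * int p = (int i - 1) * int p + int k * int p"
      by (simp add: algebra_simps)
    moreover have "i \<le> 2 * ?q" using that by simp
    ultimately show ?thesis using pre[of i] pre[OF that] by linarith
  qed
  have "cyclically_balanced s"
    unfolding cyclically_balanced_def balanced_alt
  proof (intro allI impI)
    fix i j k assume a: "i + k \<le> length (s @ s) \<and> j + k \<le> length (s @ s)"
    have "i + k \<le> 2 * ?q" "j + k \<le> 2 * ?q" using a len by auto
    from close_multiples[OF this[THEN fac]]
    show "ones (take k (drop i (s @ s))) \<le> Suc (ones (take k (drop j (s @ s))))" by linarith
  qed
  moreover have "hd s = False"
  proof -
    have "s \<noteq> []" using len p by auto
    then show ?thesis using strip_path_ones(2)[OF s, of 1] len p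
      by (cases s) (auto split: if_splits)
  qed
  ultimately show "s \<in> cyclic_words p ?q False" using len on by (simp add: cyclic_words_def)
  assume w: "w \<in> cyclic_words p ?q False"
  then have wl: "length w = ?q" "ones w = p" "cyclically_balanced w" "hd w = False"
    by (auto simp: cyclic_words_def)
  show "w \<le> s"
  proof (rule list_le_of_ones_le)
    fix k assume k: "k < length w"
    obtain w' where w': "w = False # w'" using wl p by (cases w) auto
    have "take k (drop 1 (w @ w)) = take k w'" using k w' by auto
    moreover have "1 < length w" using wl p m by simp
    ultimately have "?q * ones (take k w') < k * p + ?q"
      using cyclically_balanced_factor_bound[OF wl(3), of 1 k] wl k by simp
    moreover have "ones (take (Suc k) w) = ones (take k w')" using w' by simp
    ultimately have "int ?q * int (ones (take (Suc k) w)) < int k * int p + int ?q"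
      by (metis of_nat_add of_nat_less_iff of_nat_mult)
    also have "\<dots> \<le> int ?q * (int (ones (take (Suc k) s)) + 1)"
      using strip_path_ones(1)[OF s, of "Suc k"] k wl len by (simp add: algebra_simps)
    finally have "int (ones (take (Suc k) w)) < int (ones (take (Suc k) s)) + 1"
      using p by (metis mult_less_cancel_left_pos of_nat_0_less_iff trans_less_add1)
    then show "ones (take (Suc k) w) \<le> ones (take (Suc k) s)" by linarith
  qed (use wl len in simp)
qed

lemma map_Not_cyclic_words:
  assumes "w \<in> cyclic_words p (p + m) c" "0 < p"
  shows "map Not w \<in> cyclic_words m (p + m) (\<not> c)"
  using assms unfolding cyclic_words_def
  by (cases w) (auto simp: cyclically_balanced_map_Not ones_map_Not cyclically_balanced_map_Not[of "_ # _", simplified] Suc_diff_le ones_le_length)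

lemma finite_cyclic_words: "finite (cyclic_words p q c)"
  by (rule finite_subset[OF _ finite_lists_length_eq[of UNIV q]]) (auto simp: cyclic_words_def)

section \<open>The substitutions attached to rational slopes\<close>

text \<open>Here \<open>p\<close> and \<open>m\<close> count the ones and the zeros of \<open>M(01)\<close>, equivalently of \<open>M(10)\<close>.\<close>

inductive stern_brocot :: "substitution \<Rightarrow> nat \<Rightarrow> nat \<Rightarrow> bool" where
  "stern_brocot subst_id 1 1"
| "stern_brocot M p m \<Longrightarrow> stern_brocot (sL \<odot> M) p (m + p)"
| "stern_brocot M p m \<Longrightarrow> stern_brocot (sR \<odot> M) (p + m) m"

lemma stern_brocot_pos: "stern_brocot M p m \<Longrightarrow> 0 < p \<and> 0 < m \<and> coprime p m"
proof (induction rule: stern_brocot.induct)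
  case (2 M p m)
  then show ?case by (auto simp: coprime_iff_gcd_eq_1 add.commute[of m p])
next
  case (3 M p m)
  then show ?case by (auto simp: coprime_iff_gcd_eq_1)
qed auto

text \<open>The smaller number is subtracted from the larger until both are 1; each subtraction
  supplies one outermost \<open>sL\<close> or \<open>sR\<close>.\<close>

lemma stern_brocot_exists: "0 < p \<Longrightarrow> 0 < m \<Longrightarrow> coprime p m \<Longrightarrow> \<exists>M. stern_brocot M p m"
proof (induction "p + m" arbitrary: p m rule: less_induct)
  case less
  consider "p = m" | "p < m" | "m < p" by linarith
  then show ?case
  proof cases
    case 1
    then have "p = 1" "m = 1" using less.prems by auto
    then show ?thesis using stern_brocot.intros(1) by auto
  next
    case 2
    then have "coprime p (m - p)"
      by (metis coprime_commute coprime_diff_one_left_nat gcd_diff1_nat less.prems(3) less_imp_le coprime_iff_gcd_eq_1)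
    then obtain M where "stern_brocot M p (m - p)" using less.hyps[of p "m - p"] less.prems 2 by auto
    from stern_brocot.intros(2)[OF this] 2 show ?thesis by auto
  next
    case 3
    then have "coprime (p - m) m"
      by (metis gcd_diff1_nat less.prems(3) less_imp_le coprime_iff_gcd_eq_1)
    then obtain M where "stern_brocot M (p - m) m" using less.hyps[of "p - m" m] less.prems 3 by auto
    from stern_brocot.intros(3)[OF this] 3 show ?thesis by auto
  qed
qed

lemma stern_brocot_LR: "stern_brocot M p m \<Longrightarrow> LR M"
  by (induction rule: stern_brocot.induct) (auto intro: submonoid.intros)

lemma LR_stern_brocot: "LR M \<Longrightarrow> \<exists>p m. stern_brocot M p m"
  by (induction rule: submonoid.induct) (auto intro: stern_brocot.intros)

lemma ones_subst_elem:
  "ones (subst_word sL u) = ones u" "length (subst_word sL u) = length u + ones u"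
  "ones (subst_word sR u) = length u" "length (subst_word sR u) + ones u = 2 * length u"
  by (induction u) (auto simp: sL_def sR_def)

lemma map_Not_subst_elem:
  "map Not (subst_word sL u) = subst_word sR (map Not u)"
  "map Not (subst_word sR u) = subst_word sL (map Not u)"
  by (induction u) (auto simp: sL_def sR_def)

text \<open>Exchanging letters swaps \<open>sL\<close> with \<open>sR\<close> and ones with zeros,
  so \<open>t\<close> is treated through its complement, a path of the same kind with
  \<open>p\<close> and \<open>m\<close> exchanged.\<close>

lemma stern_brocot_words:
  assumes "stern_brocot M p m"
  defines "s \<equiv> subst_word M [False, True]" and "t \<equiv> subst_word M [True, False]"
  shows "length s = p + m \<and> ones s = p \<and> strip_path (int p) (int m) 0 0 s \<and>
    length t = p + m \<and> ones t = p \<and> strip_path (int m) (int p) 0 0 (map Not t)"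
  using assms(1) unfolding s_def t_def
proof (induction rule: stern_brocot.induct)
  case 1
  then show ?case by (simp add: in_strip_def subst_id_def)
next
  case (2 M p m)
  have pos: "0 < int p" "0 < int m" using stern_brocot_pos[OF 2(1)] by auto
  show ?case
    using 2 strip_path_L[OF pos, of 0 0] strip_path_R[OF pos(2,1), of 0 0] pos
    unfolding subst_word_comp map_Not_subst_elem
    by (simp add: ones_subst_elem del: map_map list.map map_concat)
next
  case (3 M p m)
  have pos: "0 < int p" "0 < int m" using stern_brocot_pos[OF 3(1)] by auto
  show ?case
    using 3 strip_path_R[OF pos, of 0 0] strip_path_L[OF pos(2,1), of 0 0] pos
      ones_subst_elem(4)[of "subst_word M [False, True]"] ones_subst_elem(4)[of "subst_word M [True, False]"]
    unfolding subst_word_comp map_Not_subst_elem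
    by (simp add: ones_subst_elem add.commute del: map_map list.map map_concat)
qed

definition rho :: "rat \<Rightarrow> substitution" where
  "rho r c = (if c then omega_plus r else omega_minus r)"

lemma stern_brocot_rho:
  assumes sb: "stern_brocot M p m" and r: "numer r = p" "denom r = p + m"
  shows "rho r = M \<odot> sT"
proof -
  let ?s = "subst_word M [False, True]" and ?t = "subst_word M [True, False]"
  note w = stern_brocot_words[OF sb] and pos = stern_brocot_pos[OF sb]
  have w': "length ?t = p + m" using w by blast
  have bw: "balanced_words r c = cyclic_words p (p + m) c" for c
    unfolding balanced_words_def cyclic_words_def r ..
  have "?s \<in> cyclic_words p (p + m) False" "\<And>w. w \<in> cyclic_words p (p + m) False \<Longrightarrow> w \<le> ?s"
    using strip_path_extremal[of p m ?s] w pos by blast+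
  then have "omega_minus r = ?s"
    unfolding omega_minus_def bw by (intro Max_eqI finite_cyclic_words) blast+
  moreover have "omega_plus r = ?t"
    unfolding omega_plus_def bw
  \<comment> \<open>The least word starting with 1 is the complement of the greatest word starting
    with 0 for the exchanged counts.\<close>
  proof (rule Min_eqI[OF finite_cyclic_words])
    have len: "length (map Not ?t) = m + p" "ones (map Not ?t) = m"
      and pth: "strip_path (int m) (int p) 0 0 (map Not ?t)"
      using w unfolding ones_map_Not length_map by auto
    note ext = strip_path_extremal[OF pth _ _ len]
    have "map Not ?t \<in> cyclic_words m (m + p) False" using ext(1) pos by blast
    from map_Not_cyclic_words[OF this] pos show "?t \<in> cyclic_words p (p + m) True"
      unfolding map_Not_Not by (simp only: add.commute not_False_eq_True simp_thms)
    fix w assume "w \<in> cyclic_words p (p + m) True"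
    then have "map Not w \<in> cyclic_words m (m + p) False" and len: "length w = p + m"
      using map_Not_cyclic_words[of w p m True] pos
      by (simp_all only: add.commute not_True_eq_False cyclic_words_def mem_Collect_eq simp_thms)
    then have "map Not w \<le> map Not ?t" using ext(2) pos by blast
    moreover have "length w = length ?t" using len w' by (simp only:)
    ultimately show "?t \<le> w" using map_Not_le[of w ?t] by blast
  qed
  ultimately show ?thesis by (auto simp: rho_def subst_comp_def sT_def fun_eq_iff)
qed

lemma slope_numer_denom:
  assumes "r \<in> slopes"
  shows "0 < numer r" "numer r < denom r" "coprime (numer r) (denom r)"
proof -
  obtain a b where ab: "quotient_of r = (a, b)" by (cases "quotient_of r")
  then have b: "0 < b" "coprime a b" "r = of_int a / of_int b"
    using quotient_of_denom_pos quotient_of_coprime quotient_of_div by auto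
  have "0 < r" "r < 1" using assms by auto
  then have a: "0 < a" "a < b" using b by (auto simp: zero_less_divide_iff)
  show "0 < numer r" "numer r < denom r" "coprime (numer r) (denom r)"
    using a b ab by (auto simp: numer_def denom_def coprime_int_iff[symmetric])
qed

lemma rho_LR:
  assumes "r \<in> slopes"
  obtains M where "LR M" "rho r = M \<odot> sT" "\<And>c. length (rho r c) = denom r"
proof -
  note r = slope_numer_denom[OF assms]
  have "coprime (numer r) (denom r - numer r)"
    using r by (metis coprime_iff_gcd_eq_1 gcd.commute gcd_diff1_nat less_imp_le)
  then obtain M where "stern_brocot M (numer r) (denom r - numer r)"
    using stern_brocot_exists[of "numer r" "denom r - numer r"] r by auto
  note M = this stern_brocot_words[OF this] stern_brocot_rho[OF this, of r]
  have rho: "rho r = M \<odot> sT" using M(3) r by simp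
  have "length (rho r c) = denom r" for c
    using M(2) r unfolding rho subst_comp_def sT_def by simp
  then show ?thesis using that rho stern_brocot_LR[OF M(1)] by blast
qed

lemma LR_rho:
  assumes "LR M"
  obtains r where "r \<in> slopes" "rho r = M \<odot> sT"
proof -
  obtain p m where sb: "stern_brocot M p m" using LR_stern_brocot assms by blast
  note pos = stern_brocot_pos[OF sb]
  define r where "r = Fract (int p) (int (p + m))"
  have "coprime p (p + m)" using pos by (auto simp: coprime_iff_gcd_eq_1)
  then have "coprime (int p) (int (p + m))" by (simp only: coprime_int_iff)
  then have "quotient_of r = (int p, int (p + m))" unfolding r_def
    using pos by (simp add: quotient_of_Fract normalize_stable)
  then have "numer r = p" "denom r = p + m" by (auto simp: numer_def denom_def nat_add_distrib)
  moreover have "r \<in> slopes" using pos by (auto simp: r_def zero_less_Fract_iff Fract_less_one_iff)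
  ultimately show ?thesis using that stern_brocot_rho[OF sb] by blast
qed

section \<open>Real values of infinite words\<close>

lemma summable_val: "summable (\<lambda>n. of_bool (w n) / 2 ^ Suc n :: real)"
proof (rule summable_comparison_test)
  show "\<exists>N. \<forall>n\<ge>N. norm (of_bool (w n) / 2 ^ Suc n :: real) \<le> (1 / 2) ^ n"
    by (auto simp: field_simps power_divide)
qed (simp add: summable_geometric)

lemma val_build: "val\<^sub>\<omega> (c ## x) = (of_bool c + val\<^sub>\<omega> x) / 2"
proof -
  have "(\<lambda>n. of_bool ((c ## x) (Suc n)) / 2 ^ Suc (Suc n)) sums (val\<^sub>\<omega> x / 2)"
    using sums_divide[OF summable_sums[OF summable_val[of x]], of 2]
    by (simp add: val\<^sub>\<omega>_def field_simps)
  then have "(\<lambda>n. of_bool ((c ## x) n) / 2 ^ Suc n) sums (val\<^sub>\<omega> x / 2 + of_bool ((c ## x) 0) / 2 ^ Suc 0)"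
    by (subst (asm) sums_Suc_iff) auto
  then show ?thesis unfolding val\<^sub>\<omega>_def[of "c ## x"] by (subst sums_unique[symmetric]) (auto simp: field_simps)
qed

lemma val_zeros [simp]: "val\<^sub>\<omega> \<zero>\<^sup>\<omega> = 0"
  using val_build[of False "\<zero>\<^sup>\<omega>"] by (simp add: build_const)

lemma val_ones [simp]: "val\<^sub>\<omega> \<one>\<^sup>\<omega> = 1"
  using val_build[of True "\<one>\<^sup>\<omega>"] by (simp add: build_const)

lemma val_nonneg: "0 \<le> val\<^sub>\<omega> w"
  unfolding val\<^sub>\<omega>_def by (intro suminf_nonneg summable_val) auto

lemma val_add_Not: "val\<^sub>\<omega> w + val\<^sub>\<omega> (\<lambda>n. \<not> w n) = 1"
proof -
  have "val\<^sub>\<omega> w + val\<^sub>\<omega> (\<lambda>n. \<not> w n) = (\<Sum>n. of_bool (w n) / 2 ^ Suc n + of_bool (\<not> w n) / 2 ^ Suc n)"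
    unfolding val\<^sub>\<omega>_def by (rule suminf_add[OF summable_val summable_val])
  also have "\<dots> = val\<^sub>\<omega> \<one>\<^sup>\<omega>"
    unfolding val\<^sub>\<omega>_def by (intro suminf_cong) auto
  finally show ?thesis by simp
qed

lemma val_le_1: "val\<^sub>\<omega> w \<le> 1"
  using val_add_Not[of w] val_nonneg[of "\<lambda>n. \<not> w n"] by linarith

lemma val_pos: "w k \<Longrightarrow> 0 < val\<^sub>\<omega> w"
  unfolding val\<^sub>\<omega>_def by (intro suminf_pos2[OF summable_val, of _ k]) auto

lemma val_less_1: "\<not> w k \<Longrightarrow> val\<^sub>\<omega> w < 1"
  using val_add_Not[of w] val_pos[of "\<lambda>n. \<not> w n" k] by simp

lemma val_cons: "val (c # u) = (of_bool c + val u) / 2"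
proof -
  have "val (c # u) = of_bool c / 2 + (\<Sum>n<length u. of_bool (u ! n) / 2 ^ Suc (Suc n))"
    unfolding val_def length_Cons by (subst sum.lessThan_Suc_shift) simp
  also have "(\<Sum>n<length u. of_bool (u ! n) / 2 ^ Suc (Suc n) :: real) = val u / 2"
    unfolding val_def sum_divide_distrib by (intro sum.cong) auto
  finally show ?thesis by (simp add: add_divide_distrib)
qed

lemma val_conc: "val\<^sub>\<omega> (u \<frown> x) = val u + val\<^sub>\<omega> x / 2 ^ length u"
proof (induction u)
  case (Cons c u)
  then show ?case unfolding build_cons val_build Cons val_cons by (simp add: field_simps)
qed (simp add: val_def)

lemma val_shift: "val\<^sub>\<omega> (shift n w) = (of_bool (w n) + val\<^sub>\<omega> (shift (Suc n) w)) / 2"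
  by (metis build_suffix val_build)

lemma subst_inf_shift:
  "marked f \<Longrightarrow> subst_inf f (shift n w) = f (w n) \<frown> subst_inf f (shift (Suc n) w)"
  by (metis build_suffix subst_inf_build)

lemma lex_less_split:
  assumes "x \<sqsubset> y"
  obtains u x' y' where "x = u \<frown> False ## x'" "y = u \<frown> True ## y'"
proof -
  obtain n where n: "\<forall>i<n. x i = y i" "\<not> x n" "y n" using assms unfolding lex_less_def by blast
  have x: "x = initial n x \<frown> False ## shift (Suc n) x" using n build_suffix[of x n] by simp
  have "initial n y = initial n x" using n(1) by (auto simp: subsequence_def)
  then have "y = initial n x \<frown> True ## shift (Suc n) y"
    using n build_suffix[of y n] by (metis (full_types) prefix_suffix)
  with x that show ?thesis by blast
qed

lemma val_mono: "x \<sqsubseteq> y \<Longrightarrow> val\<^sub>\<omega> x \<le> val\<^sub>\<omega> y"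
proof -
  assume "x \<sqsubseteq> y"
  then consider "x = y" | "x \<sqsubset> y" unfolding lex_le_def by blast
  then show ?thesis
  proof cases
    case 2
    then obtain u x' y' where *: "x = u \<frown> False ## x'" "y = u \<frown> True ## y'" by (rule lex_less_split)
    have "val\<^sub>\<omega> (False ## x') \<le> val\<^sub>\<omega> (True ## y')"
      using val_le_1[of x'] val_nonneg[of y'] by (simp add: val_build)
    then show ?thesis unfolding * val_conc by (simp add: divide_right_mono)
  qed simp
qed

lemma val_less_imp_lex_less: "val\<^sub>\<omega> x < val\<^sub>\<omega> y \<Longrightarrow> x \<sqsubset> y"
  using val_mono[of y x] lex_not_le by fastforce

lemma eventually_const_iff: "w \<notin> eventually_const \<longleftrightarrow> (\<forall>n c. \<exists>k\<ge>n. w k = c)"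
proof
  assume w: "w \<notin> eventually_const"
  show "\<forall>n c. \<exists>k\<ge>n. w k = c"
  proof (intro allI, rule ccontr)
    fix n c assume "\<not> (\<exists>k\<ge>n. w k = c)"
    then have "shift n w = (\<lambda>_. \<not> c)" by (auto simp: fun_eq_iff)
    then show False using w unfolding eventually_const_def by blast
  qed
next
  assume "\<forall>n c. \<exists>k\<ge>n. w k = c"
  then have "\<exists>k. w (n + k) = (\<not> c)" for n c by (metis le_Suc_ex)
  then have "shift n w \<noteq> (\<lambda>_. c)" for n c by (metis suffix_nth)
  then show "w \<notin> eventually_const"
    unfolding eventually_const_def by blast
qed

text \<open>Values of words with \<open>x \<sqsubset> y\<close> coincide only if, after a common
  prefix, they continue with 0111... and 1000...\<close>

lemma val_strict_mono:
  assumes "x \<sqsubset> y" "x \<notin> eventually_const \<or> y \<notin> eventually_const"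
  shows "val\<^sub>\<omega> x < val\<^sub>\<omega> y"
proof -
  obtain u x' y' where *: "x = u \<frown> False ## x'" "y = u \<frown> True ## y'" by (rule lex_less_split[OF assms(1)])
  have s: "shift (Suc (length u)) x = x'" "shift (Suc (length u)) y = y'"
    unfolding * by (rule HOL.ext, simp)+
  have "(\<exists>k. \<not> x' k) \<or> (\<exists>k. y' k)"
  proof (rule ccontr)
    assume "\<not> ?thesis"
    then have "x' = (\<lambda>_. True)" "y' = (\<lambda>_. False)" by auto
    then show False using assms(2) s unfolding eventually_const_def by blast
  qed
  then have "val\<^sub>\<omega> x' < 1 \<or> 0 < val\<^sub>\<omega> y'" using val_less_1 val_pos by blast
  then have "val\<^sub>\<omega> (False ## x') < val\<^sub>\<omega> (True ## y')"
    using val_le_1[of x'] val_nonneg[of y'] by (auto simp: val_build)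
  then show ?thesis unfolding * val_conc by (simp add: divide_strict_right_mono)
qed

lemma val_conc_close: "\<bar>val\<^sub>\<omega> (u \<frown> x) - val\<^sub>\<omega> (u \<frown> y)\<bar> \<le> 1 / 2 ^ length u"
proof -
  have "\<bar>val\<^sub>\<omega> x - val\<^sub>\<omega> y\<bar> \<le> 1"
    using val_le_1[of x] val_nonneg[of y] val_le_1[of y] val_nonneg[of x] by linarith
  then show ?thesis unfolding val_conc
    by (simp add: diff_divide_distrib[symmetric] divide_right_mono)
qed

abbreviation subst_val :: "substitution \<Rightarrow> bool word \<Rightarrow> real" where
  "subst_val f x \<equiv> val\<^sub>\<omega> (subst_inf f x)"

lemma subst_val_close:
  assumes "marked f"
  shows "\<bar>subst_val f (u \<frown> x) - subst_val f (u \<frown> y)\<bar> \<le> 1 / 2 ^ length u"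
proof -
  have "\<bar>subst_val f (u \<frown> x) - subst_val f (u \<frown> y)\<bar> \<le> 1 / 2 ^ length (subst_word f u)"
    unfolding subst_inf_conc[OF assms] by (rule val_conc_close)
  also have "\<dots> \<le> 1 / 2 ^ length u"
    using length_subst_word[OF assms, of u] by (auto intro!: divide_left_mono power_increasing)
  finally show ?thesis .
qed

lemma not_eventually_const_subst:
  assumes "marked f" "w \<notin> eventually_const"
  shows "subst_inf f w \<notin> eventually_const"
  unfolding eventually_const_iff
proof (intro allI)
  fix n c
  obtain m where m: "m \<ge> n" "w m = c" using assms(2) unfolding eventually_const_iff by blast
  obtain j where j: "m \<le> j" "shift j (subst_inf f w) = subst_inf f (shift m w)"
    using suffix_subst_inf[OF assms(1)] by blast
  have "subst_inf f (shift m w) = f c \<frown> subst_inf f (shift (Suc m) w)"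
    using subst_inf_shift[OF assms(1), of m w] m(2) by (simp only:)
  then have "shift j (subst_inf f w) 0 = c"
    using j marked_hd[OF assms(1), of c] by (metis build.simps(1) build_cons)
  then have "subst_inf f w j = c" by (simp only: suffix_nth add_0_right)
  then show "\<exists>k\<ge>n. subst_inf f w k = c" using j(1) m(1) le_trans by blast
qed

text \<open>Every block of \<open>sT\<close> contains both letters. So images under products with
  innermost factor \<open>sT\<close> are never eventually constant, and strict inequalities between
  words become strict for the values.\<close>

lemma not_eventually_const_T: "subst_inf sT w \<notin> eventually_const"
  unfolding eventually_const_iff
proof (intro allI)
  fix n c
  obtain j where j: "n \<le> j" "shift j (subst_inf sT w) = subst_inf sT (shift n w)"
    using suffix_subst_inf[of sT n w] by auto
  have "subst_inf sT (shift n w) = w n ## (\<not> w n) ## subst_inf sT (shift (Suc n) w)"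
    using subst_inf_shift[OF marked_elem(3), of n w] by (simp add: sT_def)
  then have "shift j (subst_inf sT w) 0 = w n" "shift j (subst_inf sT w) (Suc 0) = (\<not> w n)"
    unfolding j(2) by simp_all
  then have "subst_inf sT w j = w n" "subst_inf sT w (Suc j) = (\<not> w n)" by simp_all
  then show "\<exists>k\<ge>n. subst_inf sT w k = c" using j(1)
    by (cases "w n = c") (auto intro: exI[of _ j] exI[of _ "Suc j"])
qed

section \<open>Survivor sets and infinite words\<close>

lemma doubling_val:
  assumes "w \<notin> eventually_const"
  shows "(doubling ^^ n) (val\<^sub>\<omega> w) = val\<^sub>\<omega> (shift n w)"
proof (induction n)
  case (Suc n)
  note s = val_shift[of n w]
  \<comment> \<open>A later 1 makes the next tail positive. Otherwise the orbit could meet 1/2 with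
    letter 1, where \<open>doubling\<close> takes the left branch.\<close>
  obtain k where k: "k \<ge> Suc n" "w k" using assms unfolding eventually_const_iff by blast
  then have "shift (Suc n) w (k - Suc n)" by simp
  then have "0 < val\<^sub>\<omega> (shift (Suc n) w)" by (rule val_pos)
  then have "doubling (val\<^sub>\<omega> (shift n w)) = val\<^sub>\<omega> (shift (Suc n) w)"
    using s val_le_1[of "shift (Suc n) w"] by (auto simp: doubling_def simp del: suffix_nth)
  then show ?case by (simp only: funpow.simps o_apply Suc.IH)
qed simp

text \<open>Dyadic points are included: the error between orbit and coded value doubles at each step
  but is never larger than 1, so it vanishes.\<close>

lemma doubling_itinerary:
  assumes "x \<in> {0..1}"
  defines "w \<equiv> \<lambda>n. (doubling ^^ n) x > 1 / 2"
  shows "(doubling ^^ n) x = val\<^sub>\<omega> (shift n w)"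
proof -
  have range: "(doubling ^^ n) x \<in> {0..1}" for n
    by (induction n) (use assms in \<open>auto simp: doubling_def\<close>)
  have step: "(doubling ^^ n) x = (of_bool (w n) + (doubling ^^ Suc n) x) / 2" for n
    by (auto simp: w_def doubling_def)
  have diff: "(doubling ^^ n) x - val\<^sub>\<omega> (shift n w) = ((doubling ^^ (n + k)) x - val\<^sub>\<omega> (shift (n + k) w)) / 2 ^ k" for k
  proof (induction k)
    case (Suc k)
    have "(doubling ^^ (n + k)) x - val\<^sub>\<omega> (shift (n + k) w) =
        ((doubling ^^ (n + Suc k)) x - val\<^sub>\<omega> (shift (n + Suc k) w)) / 2"
      using val_shift[of "n + k" w] step[of "n + k"] unfolding add_Suc_right
      by (simp only: diff_divide_distrib add_divide_distrib)
    then show ?case using Suc by (simp only: power_Suc divide_divide_eq_left)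
  qed simp
  have eq: "\<bar>(doubling ^^ n) x - val\<^sub>\<omega> (shift n w)\<bar> =
      \<bar>(doubling ^^ (n + k)) x - val\<^sub>\<omega> (shift (n + k) w)\<bar> / 2 ^ k" (is "?D = ?E k / _") for k
    using arg_cong[OF diff[of k], of abs] by (simp only: abs_divide abs_numeral power_abs)
  have E: "?E k \<le> 1" for k
    using range[of "n + k"] val_nonneg[of "shift (n + k) w"] val_le_1[of "shift (n + k) w"]
    unfolding atLeastAtMost_iff by linarith
  have le: "?D \<le> (1 / 2) ^ k" for k
    unfolding eq[of k] power_one_over by (rule divide_right_mono[OF E]) simp
  show ?thesis
  proof (rule ccontr)
    assume "\<not> ?thesis"
    then have "0 < ?D" by simp
    then obtain k where "(1 / 2) ^ k < ?D" using real_arch_pow_inv[of ?D "1/2"] by auto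
    then show False using le[of k] by linarith
  qed
qed

text \<open>Survivors are coded by their itineraries. The strict inequalities leave room around the
  two bounding words, so inequalities of values give inequalities of words even at dyadic
  points.\<close>

lemma countable_survivor:
  assumes c: "countable (avoid (False ## \<alpha>) (True ## \<beta>))"
    and a: "a < val\<^sub>\<omega> (False ## \<alpha>)" and b: "val\<^sub>\<omega> (True ## \<beta>) < b"
  shows "countable (survivor a b)"
proof (rule countable_subset)
  have a2: "a < 1 / 2" using a val_le_1[of \<alpha>] by (simp add: val_build)
  have b2: "1 / 2 < b" using b val_nonneg[of \<beta>] by (simp add: val_build)
  show "survivor a b \<subseteq> val\<^sub>\<omega> ` avoid (False ## \<alpha>) (True ## \<beta>)"
  proof
    fix x assume x: "x \<in> survivor a b"
    define w where "w n \<longleftrightarrow> (doubling ^^ n) x > 1 / 2" for n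
    have x01: "x \<in> {0..1}" and av: "(doubling ^^ n) x \<notin> {a<..<b}" for n
      using x unfolding survivor_def by auto
    have it: "(doubling ^^ n) x = val\<^sub>\<omega> (shift n w)" for n
      using doubling_itinerary[OF x01] unfolding w_def .
    have "w \<in> avoid (False ## \<alpha>) (True ## \<beta>)"
      unfolding avoid_def
    proof (intro CollectI allI conjI impI)
      fix n
      assume "\<not> w n"
      then have "val\<^sub>\<omega> (shift n w) \<le> a" using av[of n] b2 it[of n] unfolding w_def by auto
      then have "shift n w \<sqsubset> False ## \<alpha>" using a by (intro val_less_imp_lex_less) simp
      then show "shift n w \<sqsubseteq> False ## \<alpha>" by (simp add: lex_le_def)
    next
      fix n
      assume "w n"
      then have "b \<le> val\<^sub>\<omega> (shift n w)" using av[of n] a2 it[of n] unfolding w_def by auto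
      then have "True ## \<beta> \<sqsubset> shift n w" using b by (intro val_less_imp_lex_less) simp
      then show "True ## \<beta> \<sqsubseteq> shift n w" by (simp add: lex_le_def)
    qed
    moreover have "x = val\<^sub>\<omega> w" using it[of 0] by simp
    ultimately show "x \<in> val\<^sub>\<omega> ` avoid (False ## \<alpha>) (True ## \<beta>)" by blast
  qed
qed (use c in simp)

lemma uncountable_words: "uncountable (UNIV :: bool word set)"
proof
  assume "countable (UNIV :: bool word set)"
  then obtain g :: "nat \<Rightarrow> bool word" where g: "UNIV = range g"
    by (metis UNIV_not_empty range_from_nat_into)
  then obtain n where "(\<lambda>k. \<not> g k k) = g n" by auto
  then show False by (metis (full_types))
qed

text \<open>Off the countable set of eventually constant words, \<open>subst_val f\<close> is
  injective and its values are survivors.\<close>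

lemma uncountable_survivor:
  assumes f: "marked f"
    and av: "\<And>w n. val\<^sub>\<omega> (shift n (subst_inf f w)) \<notin> {a<..<b}"
  shows "uncountable (survivor a b)"
proof
  assume "countable (survivor a b)"
  moreover have "(\<lambda>w. subst_val f w) ` (- eventually_const) \<subseteq> survivor a b"
    unfolding survivor_def
    using doubling_val[OF not_eventually_const_subst[OF f]] av val_nonneg val_le_1 by auto
  ultimately have "countable ((\<lambda>w. subst_val f w) ` (- eventually_const))"
    using countable_subset by blast
  moreover have "inj_on (\<lambda>w. subst_val f w) (- eventually_const)"
  proof (rule inj_onI, rule ccontr)
    fix x y assume "x \<in> - eventually_const" "y \<in> - eventually_const"
      and eq: "subst_val f x = subst_val f y" and "x \<noteq> y"
    then have "subst_inf f x \<notin> eventually_const" "subst_inf f y \<notin> eventually_const"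
      "subst_inf f x \<sqsubset> subst_inf f y \<or> subst_inf f y \<sqsubset> subst_inf f x"
      using not_eventually_const_subst[OF f] lex_linear subst_inf_less[OF f] by blast+
    then show False using val_strict_mono eq by fastforce
  qed
  ultimately have "countable (- eventually_const)" by (rule countable_image_inj_on)
  then have "countable (- eventually_const \<union> eventually_const)"
    using countable_eventually_const by blast
  then show False using uncountable_words by simp
qed

section \<open>Hausdorff dimension of countable sets\<close>

lemma hausdorff_dim_countable:
  fixes E :: "'a::metric_space set"
  assumes "countable E"
  shows "hausdorff_dim E = 0"
proof -
  have pre: "hausdorff_premeasure s d E = 0" if "0 < d" for s d
  proof -
    \<comment> \<open>Singletons cover a countable set with diameter 0; the empty set is covered
      separately, as it is not the range of a sequence.\<close>
    obtain U :: "nat \<Rightarrow> 'a set" where U: "E \<subseteq> (\<Union>i. U i)" "\<forall>i. bounded (U i) \<and> diameter (U i) = 0"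
    proof (cases "E = {}")
      case True
      then show ?thesis by (intro that[of "\<lambda>_. {}"]) auto
    next
      case False
      then obtain g :: "nat \<Rightarrow> 'a" where "E = range g" using assms by (metis range_from_nat_into)
      then show ?thesis by (intro that[of "\<lambda>i. {g i}"]) auto
    qed
    have "hausdorff_premeasure s d E \<le> (\<Sum>i. ennreal (diameter (U i) powr s))"
      unfolding hausdorff_premeasure_def using U that by (intro INF_lower) auto
    also have "\<dots> = 0" using U by simp
    finally show ?thesis by simp
  qed
  have "hausdorff_outer_measure s E = 0" for s
    unfolding hausdorff_outer_measure_def using pre by (auto simp: SUP_eq_const bot_ennreal)
  then have "hausdorff_dim E \<le> ennreal s" if "0 < s" for s
    unfolding hausdorff_dim_def using that by (intro Inf_lower) auto
  \<comment> \<open>The infimum runs over positive exponents only, so 0 is reached as a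
    limit.\<close>
  then have "hausdorff_dim E \<le> ennreal (1 / real (Suc n))" for n by simp
  moreover have "(\<lambda>n. ennreal (1 / real (Suc n))) \<longlonglongrightarrow> ennreal 0"
    by (intro tendsto_ennrealI) (use LIMSEQ_inverse_real_of_nat in \<open>simp add: inverse_eq_divide\<close>)
  ultimately have "hausdorff_dim E \<le> ennreal 0"
    by (intro LIMSEQ_le_const) auto
  then show ?thesis by simp
qed

section \<open>Obstructions to being a second order critical hole\<close>

lemma subst_val_comp: "marked f \<Longrightarrow> marked g \<Longrightarrow> subst_val (f \<odot> g) x = subst_val f (subst_inf g x)"
  by (simp add: subst_inf_comp)

text \<open>Otherwise some hole strictly inside \<open>(a, b)\<close> would have a countable
  survivor set, hence dimension 0, against the second condition of \<open>SOCH\<close>.\<close>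

lemma SOCH_not_countable:
  assumes soch: "SOCH a b" and f: "LRT f" and c: "countable (avoid (False ## \<alpha>) (True ## \<beta>))"
  shows "\<not> (a < subst_val f (False ## \<alpha>) \<and> subst_val f (True ## \<beta>) < b)"
proof
  assume ab: "a < subst_val f (False ## \<alpha>) \<and> subst_val f (True ## \<beta>) < b"
  obtain y z where yz: "subst_inf f (False ## \<alpha>) = False ## y" "subst_inf f (True ## \<beta>) = True ## z"
    using LRT_build[OF f] by metis
  \<comment> \<open>Midpoints leave room on both sides: towards \<open>a\<close> and
    \<open>b\<close> for \<open>SOCH\<close>, towards the bounding words for
    \<open>countable_survivor\<close>.\<close>
  define a' b' where "a' = (a + val\<^sub>\<omega> (False ## y)) / 2" and "b' = (b + val\<^sub>\<omega> (True ## z)) / 2"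
  have a': "a < a'" "a' < val\<^sub>\<omega> (False ## y)" and b': "b' < b" "val\<^sub>\<omega> (True ## z) < b'"
    using ab yz by (auto simp: a'_def b'_def)
  have "countable (survivor a' b')"
    using countable_survivor[OF _ a'(2) b'(2)] countable_avoid_LRT[OF f c] yz by simp
  then have "hausdorff_dim (survivor a' b') = 0" by (rule hausdorff_dim_countable)
  moreover have "hole a' b'"
    using soch a' b' val_le_1[of y] val_nonneg[of z] by (auto simp: SOCH_def hole_def val_build)
  ultimately show False using soch a' b' unfolding SOCH_def by (metis less_irrefl)
qed

text \<open>Otherwise the hole between these two values would strictly contain
  \<open>(a, b)\<close>, although all images under \<open>f\<close> avoid it, against the first
  condition of \<open>SOCH\<close>.\<close>

lemma SOCH_not_uncountable:
  assumes soch: "SOCH a b" and f: "LRT f"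
  shows "\<not> (subst_val f (False ## \<one>\<^sup>\<omega>) < a \<and> b < subst_val f (True ## \<zero>\<^sup>\<omega>))"
proof
  let ?a = "subst_val f (False ## \<one>\<^sup>\<omega>)" and ?b = "subst_val f (True ## \<zero>\<^sup>\<omega>)"
  assume ab: "?a < a \<and> b < ?b"
  obtain y where y: "subst_inf f (False ## \<one>\<^sup>\<omega>) = False ## True ## y"
    using LRT_build2[OF f, of "\<one>\<^sup>\<omega>"] by (auto simp: build_const)
  obtain z where z: "subst_inf f (True ## \<zero>\<^sup>\<omega>) = True ## False ## z"
    using LRT_build2[OF f, of "\<zero>\<^sup>\<omega>"] by (auto simp: build_const)
  have "0 < ?a" "?b < 1" unfolding y z using val_nonneg[of y] val_le_1[of z] by (auto simp: val_build)
  then have "hole ?a ?b" using ab soch unfolding hole_def SOCH_def by auto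
  moreover have "uncountable (survivor ?a ?b)"
  proof (rule uncountable_survivor[OF LRT_marked[OF f]])
    fix w n
    let ?v = "shift n (subst_inf f w)"
    have t: "False ## shift k (subst_inf f w) \<sqsubseteq> subst_inf f (False ## \<one>\<^sup>\<omega>)"
      "subst_inf f (True ## \<zero>\<^sup>\<omega>) \<sqsubseteq> True ## shift k (subst_inf f w)" for k
      using trapped_LRT[OF f, of w] unfolding trapped_def by auto
    show "val\<^sub>\<omega> ?v \<notin> {?a<..<?b}"
    proof (cases "subst_inf f w n")
      case True
      then have "?v = True ## shift (Suc n) (subst_inf f w)" by (metis build_suffix)
      then have "?b \<le> val\<^sub>\<omega> ?v" using val_mono[OF t(2)] by simp
      then show ?thesis by simp
    next
      case False
      then have "?v = False ## shift (Suc n) (subst_inf f w)" by (metis build_suffix)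
      then have "val\<^sub>\<omega> ?v \<le> ?a" using val_mono[OF t(1)] by simp
      then show ?thesis by simp
    qed
  qed
  ultimately show False using soch ab unfolding SOCH_def by blast
qed

lemma subst_val_tail_bounds:
  assumes f: "LRT f"
  shows "2 * subst_val f (True ## \<zero>\<^sup>\<omega>) - 1 \<le> val\<^sub>\<omega> (shift n (subst_inf f w))"
    and "val\<^sub>\<omega> (shift n (subst_inf f w)) \<le> 2 * subst_val f (False ## \<one>\<^sup>\<omega>)"
proof -
  have "False ## shift n (subst_inf f w) \<sqsubseteq> subst_inf f (False ## \<one>\<^sup>\<omega>)"
    "subst_inf f (True ## \<zero>\<^sup>\<omega>) \<sqsubseteq> True ## shift n (subst_inf f w)"
    using trapped_LRT[OF f, of w] unfolding trapped_def by auto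
  from this[THEN val_mono]
  show "2 * subst_val f (True ## \<zero>\<^sup>\<omega>) - 1 \<le> val\<^sub>\<omega> (shift n (subst_inf f w))"
    "val\<^sub>\<omega> (shift n (subst_inf f w)) \<le> 2 * subst_val f (False ## \<one>\<^sup>\<omega>)"
    by (simp_all add: val_build del: suffix_nth)
qed

text \<open>Continuity: words that share a long enough prefix with \<open>x\<close> have values on
  the same side of \<open>c\<close>.\<close>

lemma subst_val_approx:
  assumes "marked f" "subst_val f x \<noteq> c"
  obtains n where "\<And>u y y'. x = u \<frown> y \<Longrightarrow> n \<le> length u \<Longrightarrow>
    (subst_val f (u \<frown> y') < c \<longleftrightarrow> subst_val f x < c)"
proof -
  have "0 < \<bar>subst_val f x - c\<bar>" using assms(2) by simp
  then obtain n where n: "(1 / 2) ^ n < \<bar>subst_val f x - c\<bar>" using real_arch_pow_inv[of _ "1/2"] by fastforce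
  have "subst_val f (u \<frown> y') < c \<longleftrightarrow> subst_val f x < c"
    if x: "x = u \<frown> y" and l: "n \<le> length u" for u y y'
  proof -
    have "\<bar>subst_val f (u \<frown> y') - subst_val f x\<bar> \<le> 1 / 2 ^ length u"
      unfolding x by (rule subst_val_close[OF assms(1)])
    also have "\<dots> \<le> (1 / 2) ^ n" unfolding power_one_over using l by (intro divide_left_mono power_increasing) auto
    finally show ?thesis using n by linarith
  qed
  then show ?thesis using that by blast
qed

section \<open>Approximating eventually constant words by images\<close>

primrec sLT :: "nat \<Rightarrow> substitution" where
  "sLT 0 = sT" | "sLT (Suc n) = sL \<odot> sLT n"

primrec sRT :: "nat \<Rightarrow> substitution" where
  "sRT 0 = sT" | "sRT (Suc n) = sR \<odot> sRT n"

lemma LRT_power [simp]: "LRT (sLT n)" "LRT (sRT n)"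
  by (induction n) (auto intro: submonoid.step)

lemma marked_power [simp]: "marked (sLT n)" "marked (sRT n)"
  by (auto intro: LRT_marked)

lemma subst_word_replicate:
  "subst_word sL (replicate n False) = replicate n False"
  "subst_word sR (replicate n True) = replicate n True"
  by (induction n) (auto simp: sL_def sR_def)

text \<open>As \<open>n\<close> grows, these images agree with 1000... and 0100... on ever longer
  prefixes, and they can only lie above them.\<close>

lemma sLT_initial:
  "\<exists>y. subst_inf (sLT n) (True ## x) = (True # replicate (Suc n) False) \<frown> y"
  "\<exists>y. subst_inf (sLT n) (False ## True ## x) = (False # True # replicate n False) \<frown> y"
proof (induction n)
  case (Suc n)
  have w: "subst_word sL (True # replicate (Suc n) False) = True # replicate (Suc (Suc n)) False"
    "subst_word sL (False # True # replicate n False) = False # True # replicate (Suc n) False"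
    by (simp_all add: subst_word_replicate, simp_all add: sL_def)
  { case 1 then show ?case using Suc(1) w(1) by (metis marked_elem(1) marked_power(1) sLT.simps(2) subst_inf_comp subst_inf_conc) }
  { case 2 then show ?case using Suc(2) w(2) by (metis marked_elem(1) marked_power(1) sLT.simps(2) subst_inf_comp subst_inf_conc) }
qed auto

text \<open>Here the limits are 0111... and 1011..., approached from below.\<close>

lemma sRT_initial:
  "\<exists>y. subst_inf (sRT n) (False ## x) = (False # replicate (Suc n) True) \<frown> y"
  "\<exists>y. subst_inf (sRT n) (True ## False ## x) = (True # False # replicate n True) \<frown> y"
proof (induction n)
  case (Suc n)
  have w: "subst_word sR (False # replicate (Suc n) True) = False # replicate (Suc (Suc n)) True"
    "subst_word sR (True # False # replicate n True) = True # False # replicate (Suc n) True"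
    by (simp_all add: subst_word_replicate, simp_all add: sR_def)
  { case 1 then show ?case using Suc(1) w(1) by (metis marked_elem(2) marked_power(2) sRT.simps(2) subst_inf_comp subst_inf_conc) }
  { case 2 then show ?case using Suc(2) w(2) by (metis marked_elem(2) marked_power(2) sRT.simps(2) subst_inf_comp subst_inf_conc) }
qed auto

lemma not_eventually_const_power:
  "subst_inf (sLT n) x \<notin> eventually_const" "subst_inf (sRT n) x \<notin> eventually_const"
  by (induction n) (auto simp: not_eventually_const_T subst_inf_comp not_eventually_const_subst)

lemma conc_const_replicate: "replicate n c \<frown> (\<lambda>_. c) = (\<lambda>_. c)"
  by (rule HOL.ext) (simp add: conc_def)

lemma const_conc_eventually_const: "u \<frown> (\<lambda>_. c) \<in> eventually_const"
  unfolding eventually_const_def by (auto intro!: exI[of _ "length u"] exI[of _ c])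

lemma subst_val_strict:
  assumes "marked f" "x \<sqsubseteq> y" "x \<in> eventually_const \<longleftrightarrow> y \<notin> eventually_const"
  shows "subst_val f x < subst_val f y"
proof -
  have "x \<sqsubset> y" using assms(2,3) unfolding lex_le_def by blast
  then have "subst_inf f x \<sqsubset> subst_inf f y" by (rule subst_inf_less[OF assms(1)])
  then show ?thesis
    using assms(3) not_eventually_const_subst[OF assms(1)] by (intro val_strict_mono) blast+
qed

lemma lex_le_conc [simp]: "(u \<frown> x) \<sqsubseteq> (u \<frown> y) \<longleftrightarrow> x \<sqsubseteq> y"
  by (induction u) auto

lemma SOCH_left_corner:
  assumes soch: "SOCH a b" and f: "LRT f"
  shows "a \<le> subst_val f (False ## True ## \<zero>\<^sup>\<omega>) \<longleftrightarrow> b \<le> subst_val f (True ## \<zero>\<^sup>\<omega>)"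
proof -
  let ?x = "False ## True ## \<zero>\<^sup>\<omega>" and ?y = "True ## \<zero>\<^sup>\<omega>"
  have m: "marked f" using f by (rule LRT_marked)
  have sv: "subst_val (f \<odot> sLT n) z = subst_val f (subst_inf (sLT n) z)" for n z
    by (simp add: subst_val_comp m)
  have x: "?x = (False # True # replicate n False) \<frown> \<zero>\<^sup>\<omega>"
    and y: "?y = (True # replicate (Suc n) False) \<frown> \<zero>\<^sup>\<omega>" for n
    by (simp_all only: build_cons conc_const_replicate)
  have ex: "?x \<in> eventually_const" "?y \<in> eventually_const"
    using const_conc_eventually_const[of "[False, True]"] const_conc_eventually_const[of "[True]"]
    by simp_all
  have greater: "subst_val f ?x < subst_val f (subst_inf (sLT n) (False ## True ## z))"
    "subst_val f ?y < subst_val f (subst_inf (sLT n) (True ## z))" for n z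
  proof -
    obtain v w where "subst_inf (sLT n) (False ## True ## z) = (False # True # replicate n False) \<frown> v"
      "subst_inf (sLT n) (True ## z) = (True # replicate (Suc n) False) \<frown> w"
      using sLT_initial by metis
    then have "?x \<sqsubseteq> subst_inf (sLT n) (False ## True ## z)" "?y \<sqsubseteq> subst_inf (sLT n) (True ## z)"
      using x[of n] y[of n] lex_le_conc zeros_lex_le by metis+
    then show "subst_val f ?x < subst_val f (subst_inf (sLT n) (False ## True ## z))"
      "subst_val f ?y < subst_val f (subst_inf (sLT n) (True ## z))"
      using ex not_eventually_const_power(1) by (auto intro!: subst_val_strict[OF m])
  qed
  \<comment> \<open>For large \<open>n\<close> the hole of \<open>f \<odot> sLT n\<close> still ends
    below \<open>b\<close>, while its left end has moved strictly above \<open>a\<close>; only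
    countably many words avoid it.\<close>
  have 1: False if a: "a \<le> subst_val f ?x" and b: "subst_val f ?y < b"
  proof -
    obtain n where n: "\<And>u y y'. ?y = u \<frown> y \<Longrightarrow> n \<le> length u \<Longrightarrow>
        (subst_val f (u \<frown> y') < b \<longleftrightarrow> subst_val f ?y < b)"
      using subst_val_approx[OF m, of ?y b] b by blast
    obtain w where w: "subst_inf (sLT n) ?y = (True # replicate (Suc n) False) \<frown> w"
      using sLT_initial by blast
    have "subst_val f (subst_inf (sLT n) ?y) < b" unfolding w using n[OF y[of n]] b by simp
    moreover have "a < subst_val f (subst_inf (sLT n) ?x)" using greater(1)[of n "\<zero>\<^sup>\<omega>"] a by linarith
    ultimately show False
      using SOCH_not_countable[OF soch submonoid_comp[OF f LRT_power(1)[of n]] countable_avoid_base1]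
      unfolding sv by blast
  qed
  \<comment> \<open>Here images under \<open>f \<odot> sLT n\<close> serve as survivors: for large
    \<open>n\<close> the hole they avoid still starts below \<open>a\<close>, and it ends strictly
    above \<open>b\<close>.\<close>
  have 2: False if a: "subst_val f ?x < a" and b: "b \<le> subst_val f ?y"
  proof -
    obtain n where n: "\<And>u y y'. ?x = u \<frown> y \<Longrightarrow> n \<le> length u \<Longrightarrow>
        (subst_val f (u \<frown> y') < a \<longleftrightarrow> subst_val f ?x < a)"
      using subst_val_approx[OF m, of ?x a] a by blast
    have "False ## \<one>\<^sup>\<omega> = False ## True ## \<one>\<^sup>\<omega>" by (simp add: build_const)
    then obtain w where w: "subst_inf (sLT n) (False ## \<one>\<^sup>\<omega>) = (False # True # replicate n False) \<frown> w"
      using sLT_initial by metis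
    have "subst_val f (subst_inf (sLT n) (False ## \<one>\<^sup>\<omega>)) < a" unfolding w using n[OF x[of n]] a by simp
    moreover have "b < subst_val f (subst_inf (sLT n) ?y)" using greater(2)[of n "\<zero>\<^sup>\<omega>"] b by linarith
    ultimately show False
      using SOCH_not_uncountable[OF soch submonoid_comp[OF f LRT_power(1)[of n]]] unfolding sv by blast
  qed
  show ?thesis using 1 2 by (meson not_le)
qed

lemma SOCH_right_corner:
  assumes soch: "SOCH a b" and f: "LRT f"
  shows "a < subst_val f (False ## \<one>\<^sup>\<omega>) \<longleftrightarrow> b < subst_val f (True ## False ## \<one>\<^sup>\<omega>)"
proof -
  let ?x = "True ## False ## \<one>\<^sup>\<omega>" and ?y = "False ## \<one>\<^sup>\<omega>"
  have m: "marked f" using f by (rule LRT_marked)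
  have sv: "subst_val (f \<odot> sRT n) z = subst_val f (subst_inf (sRT n) z)" for n z
    by (simp add: subst_val_comp m)
  have x: "?x = (True # False # replicate n True) \<frown> \<one>\<^sup>\<omega>"
    and y: "?y = (False # replicate (Suc n) True) \<frown> \<one>\<^sup>\<omega>" for n
    by (simp_all only: build_cons conc_const_replicate)
  have ex: "?x \<in> eventually_const" "?y \<in> eventually_const"
    using const_conc_eventually_const[of "[True, False]"] const_conc_eventually_const[of "[False]"]
    by simp_all
  have less: "subst_val f (subst_inf (sRT n) (True ## False ## z)) < subst_val f ?x"
    "subst_val f (subst_inf (sRT n) (False ## z)) < subst_val f ?y" for n z
  proof -
    obtain v w where "subst_inf (sRT n) (True ## False ## z) = (True # False # replicate n True) \<frown> v"
      "subst_inf (sRT n) (False ## z) = (False # replicate (Suc n) True) \<frown> w"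
      using sRT_initial by metis
    then have "subst_inf (sRT n) (True ## False ## z) \<sqsubseteq> ?x" "subst_inf (sRT n) (False ## z) \<sqsubseteq> ?y"
      using x[of n] y[of n] lex_le_conc lex_le_ones by metis+
    then show "subst_val f (subst_inf (sRT n) (True ## False ## z)) < subst_val f ?x"
      "subst_val f (subst_inf (sRT n) (False ## z)) < subst_val f ?y"
      using ex not_eventually_const_power(2) by (auto intro!: subst_val_strict[OF m])
  qed
  have 1: False if a: "a < subst_val f ?y" and b: "subst_val f ?x \<le> b"
  proof -
    \<comment> \<open>The approximation lemma controls only \<open>< c\<close>; an intermediate
      \<open>c\<close> turns its negation into a strict inequality with \<open>a\<close>.\<close>
    obtain c where c: "a < c" "c < subst_val f ?y" using dense[OF a] by blast
    then obtain n where n: "\<And>u y y'. ?y = u \<frown> y \<Longrightarrow> n \<le> length u \<Longrightarrow>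
        (subst_val f (u \<frown> y') < c \<longleftrightarrow> subst_val f ?y < c)"
      using subst_val_approx[OF m, of ?y c] by auto
    obtain w where w: "subst_inf (sRT n) ?y = (False # replicate (Suc n) True) \<frown> w"
      using sRT_initial by blast
    have "\<not> subst_val f (subst_inf (sRT n) ?y) < c"
      unfolding w using n[OF y[of n]] c by simp
    then have "a < subst_val f (subst_inf (sRT n) ?y)" using c by linarith
    moreover have "subst_val f (subst_inf (sRT n) ?x) < b" using less(1)[of n "\<one>\<^sup>\<omega>"] b by linarith
    ultimately show False
      using SOCH_not_countable[OF soch submonoid_comp[OF f LRT_power(2)[of n]] countable_avoid_base2]
      unfolding sv by blast
  qed
  have 2: False if a: "subst_val f ?y \<le> a" and b: "b < subst_val f ?x"
  proof -
    obtain c where c: "b < c" "c < subst_val f ?x" using dense[OF b] by blast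
    then obtain n where n: "\<And>u y y'. ?x = u \<frown> y \<Longrightarrow> n \<le> length u \<Longrightarrow>
        (subst_val f (u \<frown> y') < c \<longleftrightarrow> subst_val f ?x < c)"
      using subst_val_approx[OF m, of ?x c] by auto
    have "True ## \<zero>\<^sup>\<omega> = True ## False ## \<zero>\<^sup>\<omega>" by (simp add: build_const)
    then obtain w where w: "subst_inf (sRT n) (True ## \<zero>\<^sup>\<omega>) = (True # False # replicate n True) \<frown> w"
      using sRT_initial by metis
    have "\<not> subst_val f (subst_inf (sRT n) (True ## \<zero>\<^sup>\<omega>)) < c"
      unfolding w using n[OF x[of n]] c by simp
    then have "b < subst_val f (subst_inf (sRT n) (True ## \<zero>\<^sup>\<omega>))" using c by linarith
    moreover have "subst_val f (subst_inf (sRT n) ?y) < a" using less(2)[of n "\<one>\<^sup>\<omega>"] a by linarith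
    ultimately show False
      using SOCH_not_uncountable[OF soch submonoid_comp[OF f LRT_power(2)[of n]]] unfolding sv by blast
  qed
  show ?thesis using 1 2 by (meson not_le)
qed

text \<open>A hole on one side of 1/2 could be enlarged and still have uncountably many survivors:
  for large \<open>n\<close>, tails of images under \<open>sRT n\<close> are bounded below by almost
  1/2, and those under \<open>sLT n\<close> are bounded above by values close to 1/2.\<close>

lemma SOCH_contains_half:
  assumes soch: "SOCH a b"
  shows "a \<le> 1 / 2" "1 / 2 \<le> b"
proof -
  have id: "marked subst_id" by simp
  have h: "hole a b" using soch unfolding SOCH_def by blast
  have big: "\<And>a' b'. hole a' b' \<Longrightarrow> a' < a \<Longrightarrow> b < b' \<Longrightarrow> countable (survivor a' b')"
    using soch unfolding SOCH_def by blast
  show "1 / 2 \<le> b"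
  proof (rule ccontr)
    assume b: "\<not> 1 / 2 \<le> b"
    \<comment> \<open>The number \<open>?c\<close> is chosen so that \<open>?c < 3/4\<close> and
      \<open>b < 2 * ?c - 1\<close>; both are equivalent to \<open>b < 1/2\<close>.\<close>
    let ?x = "True ## False ## \<one>\<^sup>\<omega>" and ?c = "b / 4 + 5 / 8"
    have vx: "val\<^sub>\<omega> ?x = 3 / 4" by (simp add: val_build)
    obtain n where n: "\<And>u y y'. ?x = u \<frown> y \<Longrightarrow> n \<le> length u \<Longrightarrow>
        (val\<^sub>\<omega> (u \<frown> y') < ?c \<longleftrightarrow> val\<^sub>\<omega> ?x < ?c)"
      using subst_val_approx[OF id, of ?x ?c] b vx by auto
    have x: "?x = (True # False # replicate n True) \<frown> \<one>\<^sup>\<omega>"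
      by (simp only: build_cons conc_const_replicate)
    have "True ## \<zero>\<^sup>\<omega> = True ## False ## \<zero>\<^sup>\<omega>" by (simp add: build_const)
    then obtain w where w: "subst_inf (sRT n) (True ## \<zero>\<^sup>\<omega>) = (True # False # replicate n True) \<frown> w"
      using sRT_initial by metis
    define b' where "b' = 2 * subst_val (sRT n) (True ## \<zero>\<^sup>\<omega>) - 1"
    have "\<not> subst_val (sRT n) (True ## \<zero>\<^sup>\<omega>) < ?c" unfolding w using n[OF x] b vx by simp
    then have b': "b < b'" using b unfolding b'_def by linarith
    have "val\<^sub>\<omega> ((True # False # replicate n True) \<frown> w) \<le> 3 / 4"
      using val_le_1 by (simp add: val_build)
    then have "hole (a / 2) b'" using h b' unfolding hole_def b'_def w by auto
    moreover have "uncountable (survivor (a / 2) b')"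
      using subst_val_tail_bounds(1)[OF LRT_power(2)[of n]] unfolding b'_def
      by (intro uncountable_survivor[OF marked_power(2)[of n]]) (auto simp: not_less simp del: suffix_nth)
    ultimately show False using big[of "a / 2" b'] b' h by (auto simp: hole_def)
  qed
  show "a \<le> 1 / 2"
  proof (rule ccontr)
    assume a: "\<not> a \<le> 1 / 2"
    let ?x = "False ## True ## \<zero>\<^sup>\<omega>" and ?c = "a / 2"
    have vx: "val\<^sub>\<omega> ?x = 1 / 4" by (simp add: val_build)
    obtain n where n: "\<And>u y y'. ?x = u \<frown> y \<Longrightarrow> n \<le> length u \<Longrightarrow>
        (val\<^sub>\<omega> (u \<frown> y') < ?c \<longleftrightarrow> val\<^sub>\<omega> ?x < ?c)"
      using subst_val_approx[OF id, of ?x ?c] a vx by auto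
    have x: "?x = (False # True # replicate n False) \<frown> \<zero>\<^sup>\<omega>"
      by (simp only: build_cons conc_const_replicate)
    have "False ## \<one>\<^sup>\<omega> = False ## True ## \<one>\<^sup>\<omega>" by (simp add: build_const)
    then obtain w where w: "subst_inf (sLT n) (False ## \<one>\<^sup>\<omega>) = (False # True # replicate n False) \<frown> w"
      using sLT_initial by metis
    define a' where "a' = 2 * subst_val (sLT n) (False ## \<one>\<^sup>\<omega>)"
    have "subst_val (sLT n) (False ## \<one>\<^sup>\<omega>) < ?c" unfolding w using n[OF x] a vx by simp
    then have a': "a' < a" unfolding a'_def by linarith
    have "1 / 4 \<le> val\<^sub>\<omega> ((False # True # replicate n False) \<frown> w)"
      using val_nonneg by (simp add: val_build)
    then have "hole a' ((b + 1) / 2)" using h a' unfolding hole_def a'_def w by auto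
    moreover have "uncountable (survivor a' ((b + 1) / 2))"
      using subst_val_tail_bounds(2)[OF LRT_power(1)[of n]] unfolding a'_def
      by (intro uncountable_survivor[OF marked_power(1)[of n]]) (auto simp: not_less simp del: suffix_nth)
    ultimately show False using big[of a' "(b + 1) / 2"] a' h by (auto simp: hole_def)
  qed
qed

section \<open>Descending through the renormalization boxes\<close>

definition Phi :: "rat list \<Rightarrow> substitution" where
  "Phi rs = foldr (\<odot>) (map rho rs) subst_id"

lemma Phi_simps [simp]: "Phi [] = subst_id" "Phi (r # rs) = rho r \<odot> Phi rs"
  by (simp_all add: Phi_def)

lemma Phi_append: "Phi (rs @ qs) = Phi rs \<odot> Phi qs"
  by (induction rs) (auto simp: subst_comp_assoc)

lemma Phi_LRT: "set rs \<subseteq> slopes \<Longrightarrow> LRT (Phi rs)"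
proof (induction rs)
  case (Cons r rs)
  have "r \<in> slopes" using Cons.prems by simp
  then obtain M where M: "LR M" "rho r = M \<odot> sT" by (rule rho_LR)
  have "LRT (rho r)" unfolding M(2) using LR_LRT[OF M(1)] by (intro submonoid_comp) auto
  then show ?case using Cons by (auto intro: submonoid_comp)
qed (auto intro: submonoid.id)

lemma foldr_subst: "foldr subst rs w = subst_word (Phi rs) w"
  by (induction rs) (auto simp: subst_word_comp subst_def rho_def[abs_def])

lemma s_word_Phi: "s_word rs = Phi rs False" and t_word_Phi: "t_word rs = Phi rs True"
  by (simp_all add: s_word_def t_word_def foldr_subst)

lemma length_Phi: "set rs \<subseteq> slopes \<Longrightarrow> length (Phi rs c) = Q rs"
proof (induction rs)
  case (Cons r rs)
  have "r \<in> slopes" using Cons.prems by simp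
  then have r: "length (rho r d) = denom r" for d by (rule rho_LR) blast
  have "length (subst_word (rho r) u) = denom r * length u" for u
    by (induction u) (auto simp: r)
  then show ?case using Cons by (simp add: Q_def subst_comp_def)
qed (simp add: Q_def subst_id_def)

lemma Q_ge: "set rs \<subseteq> slopes \<Longrightarrow> length rs < Q rs"
proof (induction rs)
  case (Cons r rs)
  have "2 \<le> denom r" using slope_numer_denom[of r] Cons.prems by auto
  then have "2 * Q rs \<le> Q (r # rs)" by (simp add: Q_def)
  then show ?case using Cons by auto
qed (simp add: Q_def)

lemma Phi_words:
  assumes "set rs \<subseteq> slopes"
  shows "subst_inf (Phi rs) \<zero>\<^sup>\<omega> = (s_word rs)\<^sup>\<omega>"
    "subst_inf (Phi rs) \<one>\<^sup>\<omega> = (t_word rs)\<^sup>\<omega>"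
    "subst_inf (Phi rs) (False ## x) = s_word rs \<frown> subst_inf (Phi rs) x"
    "subst_inf (Phi rs) (True ## x) = t_word rs \<frown> subst_inf (Phi rs) x"
  using LRT_marked[OF Phi_LRT[OF assms]]
  by (simp_all add: subst_inf_const subst_inf_build s_word_Phi t_word_Phi)

text \<open>The open box between the horizontal and the vertical segment, where the descent
  continues. For the empty list it is the product of (1/4, 1/2) and (1/2, 3/4).\<close>

definition level_box :: "rat list \<Rightarrow> real \<Rightarrow> real \<Rightarrow> bool" where
  "level_box rs a b \<longleftrightarrow>
     subst_val (Phi rs) (False ## True ## \<zero>\<^sup>\<omega>) < a \<and> a < subst_val (Phi rs) (False ## \<one>\<^sup>\<omega>) \<and>
     subst_val (Phi rs) (True ## \<zero>\<^sup>\<omega>) < b \<and> b < subst_val (Phi rs) (True ## False ## \<one>\<^sup>\<omega>)"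

section \<open>Plateaus and their end points\<close>

abbreviation zo :: "bool word" where "zo \<equiv> [False, True]\<^sup>\<omega>"
abbreviation oz :: "bool word" where "oz \<equiv> [True, False]\<^sup>\<omega>"

lemma elem_const:
  "subst_inf sL \<one>\<^sup>\<omega> = oz" "subst_inf sR \<zero>\<^sup>\<omega> = zo" "subst_inf sT \<zero>\<^sup>\<omega> = zo" "subst_inf sT \<one>\<^sup>\<omega> = oz"
  by (simp_all add: subst_inf_const, simp_all add: sL_def sR_def sT_def)

lemma False_oz: "False ## oz = zo"
proof (rule iter_unique)
  have "oz = True ## False ## oz" by (metis build_cons conc_empty iter_unroll length_greater_0_conv list.distinct(1))
  then show "False ## oz = [False, True] \<frown> False ## oz" by simp
qed simp

lemma True_zo: "True ## zo = oz"
proof (rule iter_unique)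
  have "zo = False ## True ## zo" by (metis build_cons conc_empty iter_unroll length_greater_0_conv list.distinct(1))
  then show "True ## zo = [True, False] \<frown> True ## zo" by simp
qed simp

text \<open>The right corner under \<open>sL\<close> and the left corner under \<open>sR\<close>
  become the ends of the plateau between them. The last two equations say that \<open>sL\<close>
  keeps the left end of the surrounding interval and \<open>sR\<close> its right end.\<close>

lemma corner_words:
  "subst_inf sL (False ## \<one>\<^sup>\<omega>) = zo" "subst_inf sL (True ## False ## \<one>\<^sup>\<omega>) = True ## False ## zo"
  "subst_inf sR (True ## \<zero>\<^sup>\<omega>) = oz" "subst_inf sR (False ## True ## \<zero>\<^sup>\<omega>) = False ## True ## oz"
  "subst_inf sT (False ## \<one>\<^sup>\<omega>) = False ## True ## oz" "subst_inf sT (True ## \<zero>\<^sup>\<omega>) = True ## False ## zo"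
  "subst_inf sL (False ## True ## \<zero>\<^sup>\<omega>) = False ## True ## \<zero>\<^sup>\<omega>"
  "subst_inf sR (False ## \<one>\<^sup>\<omega>) = False ## \<one>\<^sup>\<omega>"
proof -
  have "subst_inf sL \<zero>\<^sup>\<omega> = \<zero>\<^sup>\<omega>" "subst_inf sR \<one>\<^sup>\<omega> = \<one>\<^sup>\<omega>"
    using subst_inf_const[OF marked_elem(1), of False] subst_inf_const[OF marked_elem(2), of True]
    by (simp_all only: sL_def sR_def if_True if_False const_iter[symmetric])
  then show "subst_inf sL (False ## \<one>\<^sup>\<omega>) = zo"
    "subst_inf sL (True ## False ## \<one>\<^sup>\<omega>) = True ## False ## zo"
    "subst_inf sR (True ## \<zero>\<^sup>\<omega>) = oz"
    "subst_inf sR (False ## True ## \<zero>\<^sup>\<omega>) = False ## True ## oz"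
    "subst_inf sT (False ## \<one>\<^sup>\<omega>) = False ## True ## oz"
    "subst_inf sT (True ## \<zero>\<^sup>\<omega>) = True ## False ## zo"
    "subst_inf sL (False ## True ## \<zero>\<^sup>\<omega>) = False ## True ## \<zero>\<^sup>\<omega>"
    "subst_inf sR (False ## \<one>\<^sup>\<omega>) = False ## \<one>\<^sup>\<omega>"
    by (simp_all add: elem_const False_oz True_zo build_const)
qed

lemma SOCH_plateau:
  assumes soch: "SOCH a b" and h: "LRT h"
  shows "a < subst_val h zo \<longleftrightarrow> b < subst_val h (True ## False ## zo)"
    "a \<le> subst_val h (False ## True ## oz) \<longleftrightarrow> b \<le> subst_val h oz"
proof -
  have m: "marked h" by (rule LRT_marked[OF h])
  show "a < subst_val h zo \<longleftrightarrow> b < subst_val h (True ## False ## zo)"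
    using SOCH_right_corner[OF soch submonoid_comp[OF h LRT_elem(1)]]
    unfolding subst_val_comp[OF m marked_elem(1)] corner_words .
  show "a \<le> subst_val h (False ## True ## oz) \<longleftrightarrow> b \<le> subst_val h oz"
    using SOCH_left_corner[OF soch submonoid_comp[OF h LRT_elem(2)]]
    unfolding subst_val_comp[OF m marked_elem(2)] corner_words .
qed

lemma \<Delta>_eq:
  assumes rs: "set rs \<subseteq> slopes" and r: "r \<in> slopes" and M: "LR M" "rho r = M \<odot> sT"
  shows "\<Delta> (rs @ [r]) = {subst_val (Phi rs \<odot> M) zo .. subst_val (Phi rs \<odot> M) (False ## True ## oz)}"
proof -
  have rs': "set (rs @ [r]) \<subseteq> slopes" using rs r by auto
  have P: "Phi (rs @ [r]) = (Phi rs \<odot> M) \<odot> sT" by (simp add: Phi_append M(2) subst_comp_assoc)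
  have m: "marked (Phi rs \<odot> M)"
    using LRT_marked[OF submonoid_comp[OF Phi_LRT[OF rs] LR_LRT[OF M(1)]]] .
  have "\<Delta> (rs @ [r]) = {subst_val (Phi (rs @ [r])) \<zero>\<^sup>\<omega> .. subst_val (Phi (rs @ [r])) (False ## \<one>\<^sup>\<omega>)}"
    by (simp only: \<Delta>_def Phi_words[OF rs'])
  then show ?thesis
    by (simp only: P subst_inf_comp[OF m marked_elem(3)] elem_const corner_words)
qed

text \<open>The plateau equivalences bound \<open>b\<close> from both sides. The corner equivalences
  for the longer list then leave three cases: \<open>b\<close> is forced to its lower bound,
  \<open>a\<close> is forced to its upper bound, or the point lies in the next box.\<close>

lemma SOCH_inside_plateau:
  assumes soch: "SOCH a b" and rs: "set rs \<subseteq> slopes" and r: "r \<in> slopes" and a: "a \<in> \<Delta> (rs @ [r])"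
  defines "s \<equiv> s_word (rs @ [r])" and "t \<equiv> t_word (rs @ [r])"
  shows "(b = val\<^sub>\<omega> (t \<frown> s\<^sup>\<omega>) \<and> a \<in> {val\<^sub>\<omega> (s\<^sup>\<omega>) .. val\<^sub>\<omega> (s \<frown> t \<frown> s\<^sup>\<omega>)}) \<or>
    (a = val\<^sub>\<omega> (s \<frown> t\<^sup>\<omega>) \<and> b \<in> {val\<^sub>\<omega> (t \<frown> s \<frown> t\<^sup>\<omega>) .. val\<^sub>\<omega> (t\<^sup>\<omega>)}) \<or> level_box (rs @ [r]) a b"
proof -
  obtain M where M: "LR M" "rho r = M \<odot> sT" using rho_LR[OF r] .
  let ?h = "Phi rs \<odot> M" and ?P = "Phi (rs @ [r])"
  have rs': "set (rs @ [r]) \<subseteq> slopes" using rs r by auto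
  have h: "LRT ?h" using submonoid_comp[OF Phi_LRT[OF rs] LR_LRT[OF M(1)]] .
  have P: "?P = ?h \<odot> sT" by (simp add: Phi_append M(2) subst_comp_assoc)
  note m = LRT_marked[OF h]
  have Pv: "subst_val ?P x = subst_val ?h (subst_inf sT x)" for x
    unfolding P by (rule subst_val_comp[OF m marked_elem(3)])
  have "val\<^sub>\<omega> (s\<^sup>\<omega>) = subst_val ?P \<zero>\<^sup>\<omega>" "val\<^sub>\<omega> (t\<^sup>\<omega>) = subst_val ?P \<one>\<^sup>\<omega>"
    by (simp_all only: s_def t_def Phi_words[OF rs'])
  then have words: "val\<^sub>\<omega> (s\<^sup>\<omega>) = subst_val ?h zo" "val\<^sub>\<omega> (t\<^sup>\<omega>) = subst_val ?h oz"
    "val\<^sub>\<omega> (t \<frown> s\<^sup>\<omega>) = subst_val ?P (True ## \<zero>\<^sup>\<omega>)" "val\<^sub>\<omega> (s \<frown> t\<^sup>\<omega>) = subst_val ?P (False ## \<one>\<^sup>\<omega>)"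
    "val\<^sub>\<omega> (s \<frown> t \<frown> s\<^sup>\<omega>) = subst_val ?P (False ## True ## \<zero>\<^sup>\<omega>)"
    "val\<^sub>\<omega> (t \<frown> s \<frown> t\<^sup>\<omega>) = subst_val ?P (True ## False ## \<one>\<^sup>\<omega>)"
    by (simp_all only: Pv elem_const) (simp_all only: s_def t_def Pv[symmetric] Phi_words[OF rs'])
  have bounds: "subst_val ?h zo \<le> a" "a \<le> subst_val ?h (False ## True ## oz)"
    using a unfolding \<Delta>_eq[OF rs r M] by auto
  have b: "subst_val ?h (True ## False ## zo) \<le> b" "b \<le> subst_val ?h oz"
    using bounds SOCH_plateau[OF soch h] by (auto simp: not_less[symmetric])
  have b': "subst_val ?P (True ## \<zero>\<^sup>\<omega>) \<le> b" using b(1) unfolding Pv corner_words .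
  have a': "a \<le> subst_val ?P (False ## \<one>\<^sup>\<omega>)" using bounds(2) unfolding Pv corner_words .
  note L = SOCH_left_corner[OF soch Phi_LRT[OF rs']] and R = SOCH_right_corner[OF soch Phi_LRT[OF rs']]
  consider "a \<le> subst_val ?P (False ## True ## \<zero>\<^sup>\<omega>)" | "subst_val ?P (True ## False ## \<one>\<^sup>\<omega>) \<le> b"
    | "subst_val ?P (False ## True ## \<zero>\<^sup>\<omega>) < a" "b < subst_val ?P (True ## False ## \<one>\<^sup>\<omega>)" by linarith
  then show ?thesis
  proof cases
    case 1
    then have "b = subst_val ?P (True ## \<zero>\<^sup>\<omega>)" using L b' by auto
    then show ?thesis using 1 bounds unfolding words by auto
  next
    case 2
    then have "a = subst_val ?P (False ## \<one>\<^sup>\<omega>)" using R a' by auto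
    then show ?thesis using 2 b unfolding words by auto
  next
    case 3
    then have "level_box (rs @ [r]) a b" unfolding level_box_def using L R by auto
    then show ?thesis by blast
  qed
qed

section \<open>Constant difference of the end points outside the plateaus\<close>

lemma LR_central:
  assumes "LR M"
  shows "\<exists>u. subst_word M [False, True] = False # True # u \<and> subst_word M [True, False] = True # False # u"
  using assms
proof (induction rule: submonoid.induct)
  case (step g f)
  then obtain u where "subst_word f [False, True] = False # True # u"
    "subst_word f [True, False] = True # False # u" by blast
  then have eqs: "subst_word (g \<odot> f) [False, True] = subst_word g (False # True # u)"
    "subst_word (g \<odot> f) [True, False] = subst_word g (True # False # u)"
    unfolding subst_word_comp by (simp_all only:)
  from step.hyps(1) show ?case unfolding eqs by (auto simp: sL_def sR_def)
qed (simp add: subst_id_def)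

text \<open>By \<open>LR_central\<close> the images of 01 and 10 under \<open>M\<close> differ only
  in their first two letters. So the two words start with \<open>s_word rs\<close> and
  \<open>t_word rs\<close> in opposite orders and continue alike, and the difference depends neither
  on \<open>M\<close> nor on \<open>x\<close>.\<close>

lemma subst_val_swap:
  assumes rs: "set rs \<subseteq> slopes" and M: "LR M"
  shows "subst_val (Phi rs \<odot> M) (True ## False ## x) = subst_val (Phi rs \<odot> M) (False ## True ## x) +
    (1 - 1 / 2 ^ Q rs) * (val (t_word rs) - val (s_word rs))"
proof -
  obtain u where u: "subst_word M [False, True] = False # True # u" "subst_word M [True, False] = True # False # u"
    using LR_central[OF M] by blast
  note mM = LR_marked[OF M] and mP = LRT_marked[OF Phi_LRT[OF rs]]
  have "subst_inf M (False ## True ## x) = False ## True ## (u \<frown> subst_inf M x)"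
    "subst_inf M (True ## False ## x) = True ## False ## (u \<frown> subst_inf M x)"
    using subst_inf_conc[OF mM, of "[False, True]" x] subst_inf_conc[OF mM, of "[True, False]" x]
    unfolding u by simp_all
  then have "subst_val (Phi rs \<odot> M) (False ## True ## x) =
      val\<^sub>\<omega> (s_word rs \<frown> t_word rs \<frown> subst_inf (Phi rs) (u \<frown> subst_inf M x))"
    "subst_val (Phi rs \<odot> M) (True ## False ## x) =
      val\<^sub>\<omega> (t_word rs \<frown> s_word rs \<frown> subst_inf (Phi rs) (u \<frown> subst_inf M x))"
    by (simp_all only: subst_inf_comp[OF mP mM] Phi_words[OF rs])
  moreover have "length (s_word rs) = Q rs" "length (t_word rs) = Q rs"
    using length_Phi[OF rs] by (simp_all add: s_word_Phi t_word_Phi)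
  ultimately show ?thesis by (simp only: val_conc) (simp add: field_simps)
qed

lemma SOCH_outside_plateaus:
  assumes soch: "SOCH a b" and rs: "set rs \<subseteq> slopes" and level_box: "level_box rs a b"
    and out: "\<And>r. r \<in> slopes \<Longrightarrow> a \<notin> \<Delta> (rs @ [r])"
  shows "b = a + (1 - 1 / 2 ^ Q rs) * (val (t_word rs) - val (s_word rs))"
proof -
  define c where "c = (1 - 1 / 2 ^ Q rs) * (val (t_word rs) - val (s_word rs))"
  note fP = Phi_LRT[OF rs]
  note mP = LRT_marked[OF fP]
  define I where "I M = {subst_val (Phi rs \<odot> M) (False ## True ## \<zero>\<^sup>\<omega>) .. subst_val (Phi rs \<odot> M) (False ## \<one>\<^sup>\<omega>)}" for M
  \<comment> \<open>Each step composes \<open>M\<close> with \<open>sL\<close> or \<open>sR\<close>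
    on the inside, keeping \<open>a\<close> and \<open>b - c\<close> in a common interval and
    lengthening the common prefix of its end points.\<close>
  have "\<exists>M. LR M \<and> n \<le> length (subst_word M [False, True]) \<and> a \<in> I M \<and> b - c \<in> I M" for n
  proof (induction n)
    case 0
    have "LR subst_id" by (rule submonoid.id)
    moreover from subst_val_swap[OF rs this] level_box
    have "a \<in> I subst_id" "b - c \<in> I subst_id"
      unfolding I_def level_box_def c_def[symmetric]
      using subst_val_swap[OF rs \<open>LR subst_id\<close>, of "\<zero>\<^sup>\<omega>"] subst_val_swap[OF rs \<open>LR subst_id\<close>, of "\<one>\<^sup>\<omega>"]
      by (auto simp: build_const c_def)
    ultimately show ?case by blast
  next
    case (Suc n)
    then obtain M where M: "LR M" "n \<le> length (subst_word M [False, True])" "a \<in> I M" "b - c \<in> I M" by blast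
    let ?h = "Phi rs \<odot> M"
    have h: "LRT ?h" using submonoid_comp[OF fP LR_LRT[OF M(1)]] .
    note mh = LRT_marked[OF h] and mM = LR_marked[OF M(1)]
    have I: "I (M \<odot> g) = {subst_val ?h (subst_inf g (False ## True ## \<zero>\<^sup>\<omega>)) .. subst_val ?h (subst_inf g (False ## \<one>\<^sup>\<omega>))}"
      if "marked g" for g
      unfolding I_def subst_comp_assoc[symmetric] subst_inf_comp[OF mh that] ..
    obtain r where r: "r \<in> slopes" "rho r = M \<odot> sT" using LR_rho[OF M(1)] .
    have "length (subst_word M [False, True]) = length (M False) + length (M True)"
      "length (subst_word (M \<odot> sL) [False, True]) = length (M False) + length (M True) + length (M False)"
      "length (subst_word (M \<odot> sR) [False, True]) = length (M False) + length (M True) + length (M True)"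
      by (simp_all add: subst_comp_def sL_def sR_def)
    moreover have "0 < length (M c)" for c using marked_nonempty[OF mM] by simp
    from this[of False] this[of True]
    have "1 \<le> length (M False)" "1 \<le> length (M True)" by linarith+
    ultimately have len: "Suc n \<le> length (subst_word (M \<odot> sL) [False, True])"
      "Suc n \<le> length (subst_word (M \<odot> sR) [False, True])"
      using M(2) by linarith+
    have LRs: "LR (M \<odot> sL)" "LR (M \<odot> sR)"
      using submonoid_comp[OF M(1)] submonoid_elem[of sL "{sL, sR}"] submonoid_elem[of sR "{sL, sR}"]
      by blast+
    have "a \<notin> \<Delta> (rs @ [r])" using out r by blast
    \<comment> \<open>Since \<open>a\<close> misses the plateau of \<open>M\<close>, the plateau
      equivalences put \<open>b - c\<close> on the same side of it.\<close>
    then consider "a < subst_val ?h zo" | "subst_val ?h (False ## True ## oz) < a"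
      unfolding \<Delta>_eq[OF rs r(1) M(1) r(2)] by fastforce
    then show ?case
    proof cases
      case 1
      then have "b < subst_val ?h (True ## False ## zo)" using SOCH_plateau(1)[OF soch h] by blast
      then have "b - c < subst_val ?h zo"
        using subst_val_swap[OF rs M(1), of zo, unfolded True_zo False_oz, folded c_def] by linarith
      then have "a \<in> I (M \<odot> sL) \<and> b - c \<in> I (M \<odot> sL)"
        using 1 M(3,4) unfolding I[OF marked_elem(1)] corner_words unfolding I_def atLeastAtMost_iff
        by linarith
      then show ?thesis using len LRs by blast
    next
      case 2
      then have "subst_val ?h oz < b" using SOCH_plateau(2)[OF soch h] by (meson not_le)
      then have "subst_val ?h (False ## True ## oz) < b - c"
        using subst_val_swap[OF rs M(1), of oz, unfolded True_zo False_oz, folded c_def] by linarith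
      then have "a \<in> I (M \<odot> sR) \<and> b - c \<in> I (M \<odot> sR)"
        using 2 M(3,4) unfolding I[OF marked_elem(2)] corner_words unfolding I_def atLeastAtMost_iff
        by linarith
      then show ?thesis using len LRs by blast
    qed
  qed
  \<comment> \<open>Both ends of \<open>I M\<close> are values of images of words starting with
    \<open>subst_word M [False, True]\<close>, whose length controls the distance.\<close>
  moreover have "\<bar>a - (b - c)\<bar> \<le> (1 / 2) ^ n"
    if M: "LR M" "n \<le> length (subst_word M [False, True])" "a \<in> I M" "b - c \<in> I M" for n M
  proof -
    note mM = LR_marked[OF M(1)]
    have eq: "subst_inf M (False ## True ## x) = subst_word M [False, True] \<frown> subst_inf M x" for x
      using subst_inf_conc[OF mM, of "[False, True]" x] by simp
    have "False ## \<one>\<^sup>\<omega> = False ## True ## \<one>\<^sup>\<omega>" by (simp add: build_const)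
    then have "\<bar>a - (b - c)\<bar> \<le> \<bar>subst_val (Phi rs) (subst_inf M (False ## True ## \<one>\<^sup>\<omega>)) -
        subst_val (Phi rs) (subst_inf M (False ## True ## \<zero>\<^sup>\<omega>))\<bar>"
      using M(3,4) unfolding I_def subst_inf_comp[OF mP mM] by auto
    also have "\<dots> \<le> 1 / 2 ^ length (subst_word M [False, True])"
      unfolding eq by (rule subst_val_close[OF mP])
    also have "\<dots> \<le> (1 / 2) ^ n"
      unfolding power_one_over using M(2) by (intro divide_left_mono power_increasing) auto
    finally show ?thesis .
  qed
  ultimately have le: "\<bar>a - (b - c)\<bar> \<le> (1 / 2) ^ n" for n by blast
  have "a = b - c"
  proof (rule ccontr)
    assume "a \<noteq> b - c"
    then obtain n where "(1 / 2) ^ n < \<bar>a - (b - c)\<bar>" using real_arch_pow_inv[of "\<bar>a - (b - c)\<bar>" "1/2"] by auto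
    then show False using le[of n] by linarith
  qed
  then show ?thesis unfolding c_def by simp
qed

section \<open>Infinitely renormalizable holes\<close>

text \<open>Each word extends the previous one and \<open>u k\<close> already has a letter at
  position \<open>k\<close>, so that letter never changes again.\<close>

lemma word_lim_nth:
  assumes ext: "\<And>n. \<exists>v. u (Suc n) = u n @ v" and len: "\<And>n. n < length (u n)" and k: "k \<le> n"
  shows "word_lim u k = u n ! k"
proof -
  have pre: "\<exists>v. u (k + d) = u k @ v" for d
  proof (induction d)
    case (Suc d)
    then show ?case using ext[of "k + d"] by auto
  qed simp
  have nth: "k < length (u m) \<and> u m ! k = u k ! k" if m: "k \<le> m" for m
  proof -
    obtain v where "u m = u k @ v" using pre[of "m - k"] le_add_diff_inverse[OF m] by metis
    then show ?thesis using len[of k] by (simp add: nth_append)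
  qed
  have "word_lim u k = u k ! k"
    unfolding word_lim_def
  proof (rule the_equality)
    show "\<forall>\<^sub>F m in sequentially. k < length (u m) \<and> u m ! k = u k ! k"
      unfolding eventually_sequentially using nth by blast
    fix c assume "\<forall>\<^sub>F m in sequentially. k < length (u m) \<and> u m ! k = c"
    then obtain N where "\<forall>m\<ge>N. k < length (u m) \<and> u m ! k = c"
      unfolding eventually_sequentially by blast
    then show "c = u k ! k" using nth[of "max N k"] by (metis max.cobounded1 max.cobounded2)
  qed
  then show ?thesis using nth[OF k] by simp
qed

lemma val_word_lim:
  assumes ext: "\<And>n. \<exists>v. u (Suc n) = u n @ v" and len: "\<And>n. n < length (u n)"
    and bounds: "\<And>n. \<exists>y z. val\<^sub>\<omega> (u n \<frown> y) \<le> a \<and> a \<le> val\<^sub>\<omega> (u n \<frown> z)"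
  shows "a = val\<^sub>\<omega> (word_lim u)"
proof -
  have le: "\<bar>a - val\<^sub>\<omega> (word_lim u)\<bar> \<le> (1 / 2) ^ n" for n
  proof -
    obtain y z where yz: "val\<^sub>\<omega> (u n \<frown> y) \<le> a" "a \<le> val\<^sub>\<omega> (u n \<frown> z)" using bounds by blast
    have "initial n (word_lim u) = take n (u n)"
      using len[of n] word_lim_nth[OF ext len] by (intro nth_equalityI) auto
    then have w: "word_lim u = take n (u n) \<frown> shift n (word_lim u)" by (metis prefix_suffix)
    have u: "u n \<frown> x = take n (u n) \<frown> drop n (u n) \<frown> x" for x by simp
    have "\<bar>val\<^sub>\<omega> (u n \<frown> x) - val\<^sub>\<omega> (word_lim u)\<bar> \<le> 1 / 2 ^ length (take n (u n))" for x
      using val_conc_close[of "take n (u n)" "drop n (u n) \<frown> x" "shift n (word_lim u)"]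
      unfolding u[symmetric] w[symmetric] .
    from this[of y] this[of z] yz len[of n] show ?thesis by (simp add: power_one_over)
  qed
  show ?thesis
  proof (rule ccontr)
    assume "\<not> ?thesis"
    then obtain n where "(1 / 2) ^ n < \<bar>a - val\<^sub>\<omega> (word_lim u)\<bar>"
      using real_arch_pow_inv[of "\<bar>a - val\<^sub>\<omega> (word_lim u)\<bar>" "1/2"] by auto
    then show False using le[of n] by linarith
  qed
qed

lemma rho_marked: "r \<in> slopes \<Longrightarrow> marked (rho r)"
  using Phi_LRT[of "[r]"] LRT_marked by fastforce

text \<open>A new slope acts on the inside and \<open>rho\<close> is marked, so each word is a
  prefix of the next. Both bounds on \<open>a\<close> in a box begin with the word of 0, both bounds
  on \<open>b\<close> with that of 1.\<close>

lemma nested_boxes_limit: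
  assumes r: "\<And>i. r i \<in> slopes" and boxes: "\<And>n. level_box (map r [0..<n]) a b"
  shows "a = val\<^sub>\<omega> (s_lim r)" "b = val\<^sub>\<omega> (t_lim r)"
proof -
  have rs: "set (map r [0..<n]) \<subseteq> slopes" for n using r by auto
  have ext: "\<exists>v. Phi (map r [0..<Suc n]) c = Phi (map r [0..<n]) c @ v" for n c
  proof -
    have "Phi (map r [0..<Suc n]) c = subst_word (Phi (map r [0..<n])) (rho (r n) c)"
      by (simp add: Phi_append) (simp add: subst_comp_def)
    then show ?thesis using marked_hd[OF rho_marked[OF r], of n c] by (metis concat.simps(2) list.simps(9))
  qed
  have len: "n < length (Phi (map r [0..<n]) c)" for n c
    using length_Phi[OF rs, of n c] Q_ge[OF rs, of n] by simp
  note words = Phi_words(3,4)[OF rs, unfolded s_word_Phi t_word_Phi]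
  show "a = val\<^sub>\<omega> (s_lim r)"
    unfolding s_lim_def s_word_Phi
  proof (rule val_word_lim)
    fix n
    show "\<exists>y z. val\<^sub>\<omega> (Phi (map r [0..<n]) False \<frown> y) \<le> a \<and> a \<le> val\<^sub>\<omega> (Phi (map r [0..<n]) False \<frown> z)"
      using boxes[of n] unfolding level_box_def words by (meson less_imp_le)
  qed (use ext len in blast)+
  show "b = val\<^sub>\<omega> (t_lim r)"
    unfolding t_lim_def t_word_Phi
  proof (rule val_word_lim)
    fix n
    show "\<exists>y z. val\<^sub>\<omega> (Phi (map r [0..<n]) True \<frown> y) \<le> b \<and> b \<le> val\<^sub>\<omega> (Phi (map r [0..<n]) True \<frown> z)"
      using boxes[of n] unfolding level_box_def words by (meson less_imp_le)
  qed (use ext len in blast)+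
qed

lemma nested_boxes_choice:
  assumes base: "level_box [] a b"
    and step: "\<And>rs. set rs \<subseteq> slopes \<Longrightarrow> level_box rs a b \<Longrightarrow> \<exists>r\<in>slopes. level_box (rs @ [r]) a b"
  obtains r where "\<And>i. r i \<in> slopes" "\<And>n. level_box (map r [0..<n]) a b"
proof -
  obtain R where R: "\<And>rs. set rs \<subseteq> slopes \<Longrightarrow> level_box rs a b \<Longrightarrow> R rs \<in> slopes \<and> level_box (rs @ [R rs]) a b"
    using step by metis
  \<comment> \<open>The recursion produces whole lists, because the next slope may depend on all
    previous ones.\<close>
  define L where "L = rec_nat [] (\<lambda>_ rs. rs @ [R rs])"
  have L: "L 0 = []" "L (Suc n) = L n @ [R (L n)]" for n by (simp_all add: L_def)
  have inv: "set (L n) \<subseteq> slopes \<and> level_box (L n) a b" for n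
    by (induction n) (use base R in \<open>auto simp: L\<close>)
  have map: "map (\<lambda>i. R (L i)) [0..<n] = L n" for n by (induction n) (auto simp: L)
  show ?thesis
  proof (rule that[of "\<lambda>i. R (L i)"])
    show "R (L i) \<in> slopes" for i using R inv by blast
    show "level_box (map (\<lambda>i. R (L i)) [0..<n]) a b" for n unfolding map using inv by blast
  qed
qed

theorem theorem3p8:
  fixes a b :: real
  assumes "SOCH a b"
  shows
    "(\<exists>c\<in>{0<..1/4}. (a, b) = (c, 1/2) \<or> (a, b) = (1/2, 1 - c))
     \<or> (a \<in> S_set \<and> b = a + 1/4)
     \<or> (\<exists>rs. rs \<noteq> [] \<and> set rs \<subseteq> slopes \<and> a \<in> S_sets rs \<and>
           b = a + (1 - 1 / 2 ^ Q rs) * (val (t_word rs) - val (s_word rs)))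
     \<or> (\<exists>rs. rs \<noteq> [] \<and> set rs \<subseteq> slopes \<and> a = val\<^sub>\<omega> (s_word rs \<frown> (t_word rs)\<^sup>\<omega>) \<and>
           b \<in> {val\<^sub>\<omega> (t_word rs \<frown> s_word rs \<frown> (t_word rs)\<^sup>\<omega>) .. val\<^sub>\<omega> ((t_word rs)\<^sup>\<omega>)})
     \<or> (\<exists>rs. rs \<noteq> [] \<and> set rs \<subseteq> slopes \<and> b = val\<^sub>\<omega> (t_word rs \<frown> (s_word rs)\<^sup>\<omega>) \<and>
           a \<in> {val\<^sub>\<omega> ((s_word rs)\<^sup>\<omega>) .. val\<^sub>\<omega> (s_word rs \<frown> t_word rs \<frown> (s_word rs)\<^sup>\<omega>)})
     \<or> (\<exists>r :: nat \<Rightarrow> rat. (\<forall>i. r i \<in> slopes) \<and> a = val\<^sub>\<omega> (s_lim r) \<and> b = val\<^sub>\<omega> (t_lim r))"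
    (is "?I \<or> ?II \<or> ?III \<or> ?IV \<or> ?V \<or> ?VI")
proof -
  note soch = assms
  have hole: "0 < a" "b < 1" using soch by (auto simp: SOCH_def hole_def)
  note half = SOCH_contains_half[OF soch]
  have vals: "val\<^sub>\<omega> (False ## True ## \<zero>\<^sup>\<omega>) = 1 / 4" "val\<^sub>\<omega> (True ## \<zero>\<^sup>\<omega>) = 1 / 2"
    "val\<^sub>\<omega> (False ## \<one>\<^sup>\<omega>) = 1 / 2" "val\<^sub>\<omega> (True ## False ## \<one>\<^sup>\<omega>) = 3 / 4"
    by (simp_all add: val_build)
  have L: "a \<le> 1 / 4 \<longleftrightarrow> b \<le> 1 / 2" and R: "a < 1 / 2 \<longleftrightarrow> b < 3 / 4"
    using SOCH_left_corner[OF soch submonoid.id] SOCH_right_corner[OF soch submonoid.id]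
    by (simp_all add: vals)
  \<comment> \<open>The corner equivalences of the identity and \<open>SOCH_contains_half\<close>
    settle the two outer ranges.\<close>
  consider "a \<le> 1 / 4" | "1 / 2 \<le> a" | "1 / 4 < a" "a < 1 / 2" by linarith
  then show ?thesis
  proof cases
    case 1
    then have "a \<in> {0<..1/4}" "b = 1 / 2" using L half hole by auto
    then show ?thesis by blast
  next
    case 2
    then have "1 - b \<in> {0<..1/4}" "(a, b) = (1/2, 1 - (1 - b))" using R half hole by auto
    then show ?thesis by blast
  next
    case 3
    then have box0: "level_box [] a b" using L R by (simp add: level_box_def vals)
    \<comment> \<open>One round of the descent: off the plateaus the difference \<open>b - a\<close>
      is determined, on a plateau the hole lies on a segment or in the next box.\<close>
    have step: "(?II \<or> ?III) \<or> (?IV \<or> ?V) \<or> (\<exists>r\<in>slopes. level_box (rs @ [r]) a b)"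
      if rs: "set rs \<subseteq> slopes" and level_box: "level_box rs a b" for rs
    proof (cases "\<exists>r\<in>slopes. a \<in> \<Delta> (rs @ [r])")
      case True
      then obtain r where r: "r \<in> slopes" "a \<in> \<Delta> (rs @ [r])" by blast
      have rs': "rs @ [r] \<noteq> []" "set (rs @ [r]) \<subseteq> slopes" using rs r by auto
      from SOCH_inside_plateau[OF soch rs r] rs' r(1) show ?thesis by blast
    next
      case False
      then have eq: "b = a + (1 - 1 / 2 ^ Q rs) * (val (t_word rs) - val (s_word rs))"
        by (intro SOCH_outside_plateaus[OF soch rs level_box]) blast
      show ?thesis
      proof (cases "rs = []")
        case True
        \<comment> \<open>For the empty list \<open>Q rs = 1\<close>, and the words 0 and 1 have
          values 0 and 1/2.\<close>
        then have "b = a + 1 / 4" using eq by (simp add: s_word_Phi t_word_Phi Q_def val_def subst_id_def)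
        moreover have "a \<in> S_set" using False 3 True unfolding S_set_def by simp
        ultimately show ?thesis by blast
      next
        case nonempty: False
        have "a \<in> \<Delta>\<^sub>t rs" using level_box unfolding level_box_def \<Delta>\<^sub>t_def Phi_words[OF rs] by simp
        then have "a \<in> S_sets rs" using False unfolding S_sets_def by blast
        then show ?thesis using eq rs nonempty by blast
      qed
    qed
    show ?thesis
    \<comment> \<open>If no round stops the descent, the boxes for one infinite sequence of slopes
      shrink to the limit words.\<close>
    proof (cases "(?II \<or> ?III) \<or> (?IV \<or> ?V)")
      case False
      then have "\<exists>r\<in>slopes. level_box (rs @ [r]) a b" if "set rs \<subseteq> slopes" "level_box rs a b" for rs
        using step[OF that] by blast
      from nested_boxes_choice[OF box0 this] obtain r
        where r: "\<And>i. r i \<in> slopes" "\<And>n. level_box (map r [0..<n]) a b" by blast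
      have ?VI using r(1) nested_boxes_limit[OF r] by blast
      then show ?thesis by blast
    qed blast
  qed
qed

end
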